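(* Let $G=(V,E)$ be a finite graph. Then for every $u,v\in V$, every $t\subseteq V$, and every $p$ with $1-2^{-|E|/2-2}\leqslant p<1$, \[ \mathbb{P}^{\mathrm{bb}}_p\big((u,0)\leftrightarrow (v,0)\mid T=t\big) \;\geqslant\; \mathbb{P}^{\mathrm{bb}}_p\big((u,0)\leftrightarrow (v,1)\mid T=t\big), \] with strict inequality if and only if $u$ and $v$ are connected in the subgraph of $G$ induced by $V\setminus t$ (in particular this requires $u,v\notin t$).
   Context: Graphs are allowed to contain self-loops and multiple edges. The bunkbed graph of $G=(V,E)$ is the Cartesian product $G\times K_2$: its vertex set is $V\times\{0,1\}$; for every edge $e$ of $G$ with endpoints $x,y$ there are two "horizontal" edges, one joining $(x,0)$ to $(y,0)$ and one joining $(x,1)$ to $(y,1)$; and for every $w\in V$ there is one "vertical" edge joining $(w,0)$ and $(w,1)$. $\mathbb{P}^{\mathrm{bb}}_p$ denotes the law of Bernoulli bond percolation with parameter $p$ on $G\times K_2$: each edge is independently open with probability $p$ and closed otherwise, and $a\leftrightarrow b$ denotes the event that $a$ and $b$ are joined by a path of open edges. $T\subseteq V$ denotes the random set of vertices $w$ whose vertical edge $\{(w,0),(w,1)\}$ is open (for $0<p<1$ every $t\subseteq V$ has positive probability). *)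

theory Defs
  imports "HOL-Probability.Probability" "HOL-Library.Uprod"
begin

(* Undirected multigraphs: edges are abstract names, so parallel edges are allowed;
   the endpoints form an unordered pair, and Upair x x is a self-loop. *)
record ('v, 'e) multigraph =
  verts :: "'v set"
  edges :: "'e set"
  ends :: "'e \<Rightarrow> 'v uprod"

locale finite_multigraph =
  fixes G :: "('v, 'e) multigraph"
  assumes finite_verts: "finite (verts G)"
    and finite_edges: "finite (edges G)"
    and ends_in_verts: "e \<in> edges G \<Longrightarrow> set_uprod (ends G e) \<subseteq> verts G"

definition adjacent :: "('v, 'e) multigraph \<Rightarrow> 'v \<Rightarrow> 'v \<Rightarrow> bool" where
  "adjacent G x y \<longleftrightarrow> (\<exists>e \<in> edges G. ends G e = Upair x y)"

definition graph_path :: "('v, 'e) multigraph \<Rightarrow> 'v list \<Rightarrow> bool" where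
  "graph_path G xs \<longleftrightarrow>
     xs \<noteq> [] \<and> distinct xs \<and> set xs \<subseteq> verts G \<and> successively (adjacent G) xs"

(* Every vertex of G is joined to itself, by the path of length 0;
   a point outside the vertex set is joined to nothing, not even to itself. *)
definition joined :: "('v, 'e) multigraph \<Rightarrow> 'v \<Rightarrow> 'v \<Rightarrow> bool" where
  "joined G x y \<longleftrightarrow> (\<exists>xs. graph_path G xs \<and> hd xs = x \<and> last xs = y)"

lemma joined_in_verts:
  assumes "joined G x y"
  shows "x \<in> verts G" and "y \<in> verts G"
  using assms unfolding joined_def graph_path_def
  by (auto dest: hd_in_set last_in_set)

definition induced_subgraph :: "('v, 'e) multigraph \<Rightarrow> 'v set \<Rightarrow> ('v, 'e) multigraph" where
  "induced_subgraph G W =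
     \<lparr>verts = W, edges = {e \<in> edges G. set_uprod (ends G e) \<subseteq> W}, ends = ends G\<rparr>"

datatype ('v, 'e) bb_edge = Horizontal 'e nat | Vertical 'v

fun bb_ends :: "('v, 'e) multigraph \<Rightarrow> ('v, 'e) bb_edge \<Rightarrow> ('v \<times> nat) uprod" where
  "bb_ends G (Horizontal e i) = map_uprod (\<lambda>x. (x, i)) (ends G e)"
| "bb_ends G (Vertical w) = Upair (w, 0) (w, 1)"

definition bunkbed :: "('v, 'e) multigraph \<Rightarrow> ('v \<times> nat, ('v, 'e) bb_edge) multigraph" where
  "bunkbed G =
     \<lparr>verts = verts G \<times> {0, 1},
      edges = {Horizontal e i | e i. e \<in> edges G \<and> i \<in> {0, 1}} \<union> Vertical ` verts G,
      ends = bb_ends G\<rparr>"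

(* A configuration maps each edge to True (open) or False (closed);
   it is False by convention outside the edge set. *)
definition percolation :: "('v, 'e) multigraph \<Rightarrow> real \<Rightarrow> ('e \<Rightarrow> bool) pmf" where
  "percolation G p = Pi_pmf (edges G) False (\<lambda>_. bernoulli_pmf p)"

definition open_subgraph :: "('v, 'e) multigraph \<Rightarrow> ('e \<Rightarrow> bool) \<Rightarrow> ('v, 'e) multigraph" where
  "open_subgraph G \<omega> =
     \<lparr>verts = verts G, edges = {e \<in> edges G. \<omega> e}, ends = ends G\<rparr>"

definition open_verticals :: "('v, 'e) multigraph \<Rightarrow> (('v, 'e) bb_edge \<Rightarrow> bool) \<Rightarrow> 'v set" where
  "open_verticals G \<omega> = {w \<in> verts G. \<omega> (Vertical w)}"

definition bb_cond_prob ::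
  "('v, 'e) multigraph \<Rightarrow> real \<Rightarrow> 'v \<times> nat \<Rightarrow> 'v \<times> nat \<Rightarrow> 'v set \<Rightarrow> real" where
  "bb_cond_prob G p a b t =
     \<P>(\<omega> in percolation (bunkbed G) p.
        joined (open_subgraph (bunkbed G) \<omega>) a b \<bar> open_verticals G \<omega> = t)"

end

(*
  Given T = t, describe a configuration by its set F of closed horizontal edges and weight it by r^|F|
  with r = (1 - p)/p. A set W containing v is good for F if every edge leaving W which is not closed on
  both levels ends at a vertex y whose two copies are joined outside W. Swapping the two levels on the
  edges that meet a good set not containing u exchanges the events (u,0) <-> (v,0) and (u,0) <-> (v,1),
  and applied to the smallest good set (the core) it is a weight-preserving involution. So only the
  configurations with u in the core W matter. There, unless neither or both events occur, W avoids t and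
  every edge leaving W is closed on at least one level. If only (u,0) <-> (v,1) occurs, some edge inside W
  is closed:
  - if a single edge e inside W is closed (on one level), it separates u from v in W, and swapping the
    levels around the v-side of e gives injectively a configuration where only (u,0) <-> (v,0) occurs;
  - if at least two are closed, open everything inside W and let the one-level closures around W all lie
    on level 1: this detaches level 1 of W, so only (u,0) <-> (v,0) occurs. The gain of r^2 beats the
    number 2^|boundary| of preimages by the assumption on p.
  Configurations as in the last step, with core W and no edge inside W closed, exist if and only if u and v
  are connected off t; they give the strict inequality.
*)
theory Submission
  imports Defs
begin

subsection \<open>Preliminaries\<close>

lemma sum_power_card_Pow:
  fixes r :: real
  assumes "finite S"
  shows "(\<Sum>I\<in>Pow S. r ^ card I) = (1 + r) ^ card S"
proof -
  have "(\<Sum>I\<in>Pow S. r ^ card I) = (\<Sum>I\<in>Pow S. prod (\<lambda>_. r) I * prod (\<lambda>_. 1) (S - I))"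
    by simp
  also have "\<dots> = (\<Prod>x\<in>S. r + 1)"
    using assms by (subst prod_add) (simp_all add: add.commute)
  finally show ?thesis by (simp add: add.commute)
qed

text \<open>From the binomial sum over all subsets, the terms of the empty set and of the singletons
  are removed. Later \<open>S\<close> consists of the two copies of each edge inside a core.\<close>

lemma sum_power_card_ge_2:
  fixes r :: real
  assumes "finite S"
  shows "(\<Sum>I | I \<subseteq> S \<and> 2 \<le> card I. r ^ card I) = (1 + r) ^ card S - 1 - real (card S) * r"
proof -
  have "(\<Sum>I\<in>Pow S. r ^ card I) =
      (\<Sum>I | I \<subseteq> S \<and> 2 \<le> card I. r ^ card I) + (\<Sum>I | I \<subseteq> S \<and> card I \<le> 1. r ^ card I)"
    using assms by (subst sum.union_disjoint[symmetric]) (auto intro!: sum.cong)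
  also have "{I. I \<subseteq> S \<and> card I \<le> 1} = insert {} ((\<lambda>x. {x}) ` S)"
    using assms by (auto simp: le_Suc_eq card_1_singleton_iff dest: finite_subset)
  also have "(\<Sum>I\<in>\<dots>. r ^ card I) = 1 + real (card S) * r"
    using assms by (subst sum.insert) (auto simp: sum.reindex)
  finally show ?thesis using sum_power_card_Pow[OF assms, of r] by simp
qed

text \<open>The ratio i^2 / 2^i is largest at i = 3, where equality holds; from there on, one step
  at most doubles the square.\<close>

lemma eight_squares_le: "8 * i\<^sup>2 \<le> 9 * 2 ^ i" for i :: nat
proof (cases "3 \<le> i")
  case True
  then show ?thesis
  proof (induction i rule: dec_induct)
    case (step n)
    have "3 * n \<le> n * n" using step.hyps by simp
    moreover have "Suc n * Suc n = n * n + 2 * n + 1" by simp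
    ultimately have "(Suc n)\<^sup>2 \<le> 2 * n\<^sup>2" using step.hyps unfolding power2_eq_square by linarith
    then show ?case using step.IH by simp
  qed simp
next
  case False
  then have "i = 0 \<or> i = 1 \<or> i = 2" by auto
  then show ?thesis by auto
qed

text \<open>A walk turns into a path with distinct vertices: when its next vertex already lies on
  the path, the path is cut there. The condition on \<open>x\<close> excludes the empty walk at a
  point outside the graph.\<close>

lemma joined_iff_rtrancl:
  "joined H x y \<longleftrightarrow>
     x \<in> verts H \<and> (x, y) \<in> {(a, b). a \<in> verts H \<and> b \<in> verts H \<and> adjacent H a b}\<^sup>*"
  (is "_ \<longleftrightarrow> _ \<and> _ \<in> ?R\<^sup>*")
proof
  have "(hd xs, last xs) \<in> ?R\<^sup>*"
    if "xs \<noteq> []" "set xs \<subseteq> verts H" "successively (adjacent H) xs" for xs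
    using that
  proof (induction xs)
    case (Cons a xs)
    show ?case
    proof (cases xs)
      case (Cons b ys)
      then have "(a, b) \<in> ?R" "(b, last xs) \<in> ?R\<^sup>*"
        using Cons.prems Cons.IH by auto
      then show ?thesis using Cons by (auto intro: converse_rtrancl_into_rtrancl)
    qed simp
  qed simp
  then show "joined H x y \<Longrightarrow> x \<in> verts H \<and> (x, y) \<in> ?R\<^sup>*"
    using joined_in_verts(1)[of H x y] unfolding joined_def graph_path_def by blast
next
  assume xy: "x \<in> verts H \<and> (x, y) \<in> ?R\<^sup>*"
  then have "(x, y) \<in> ?R\<^sup>*" by simp
  then show "joined H x y"
  proof (induction rule: rtrancl_induct)
    case base
    have "graph_path H [x]" using xy by (simp add: graph_path_def)
    then show ?case by (force simp: joined_def)
  next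
    case (step y z)
    then obtain xs where xs: "graph_path H xs" "hd xs = x" "last xs = y" by (auto simp: joined_def)
    show ?case
    proof (cases "z \<in> set xs")
      case False
      then have "graph_path H (xs @ [z])"
        using xs step.hyps by (auto simp: graph_path_def successively_append_iff)
      then show ?thesis using xs by (auto simp: joined_def graph_path_def intro!: exI[of _ "xs @ [z]"])
    next
      case True
      then obtain ys zs where xs_eq: "xs = (ys @ [z]) @ zs" by (metis append.assoc append_Cons append_Nil split_list)
      have "graph_path H (ys @ [z])"
        using xs(1) unfolding xs_eq graph_path_def successively_append_iff[of _ "ys @ [z]"] by auto
      moreover have "hd (ys @ [z]) = x"
        using xs(2) unfolding xs_eq by (cases ys) auto
      ultimately show ?thesis by (auto simp: joined_def intro!: exI[of _ "ys @ [z]"])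
    qed
  qed
qed

subsection \<open>Flipping the core of a configuration\<close>

locale bunkbed_target = finite_multigraph G
  for G :: "('v, 'e) multigraph" +
  fixes t :: "'v set" and v :: 'v
  assumes v_in_verts: "v \<in> verts G"
begin

section \<open>Connectivity in a configuration, good sets and the core\<close>

definition link :: "'e \<Rightarrow> 'v \<Rightarrow> 'v \<Rightarrow> bool" where
  "link e x y \<longleftrightarrow> e \<in> edges G \<and> ends G e = Upair x y"

definition int_edges :: "'v set \<Rightarrow> 'e set" where
  "int_edges W = {e. \<exists>x y. link e x y \<and> x \<in> W \<and> y \<in> W}"

definition bd_edges :: "'v set \<Rightarrow> 'e set" where
  "bd_edges W = {e. \<exists>x y. link e x y \<and> x \<in> W \<and> y \<notin> W}"

definition touching :: "'v set \<Rightarrow> 'e set" where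
  "touching W = {e. \<exists>x y. link e x y \<and> x \<in> W}"

text \<open>Here and below \<open>F\<close> is the set of \<^emph>\<open>closed\<close> horizontal edges, the levels 0 and 1 being
  encoded as \<open>False\<close> and \<open>True\<close>; the open vertical edges are those at \<open>t\<close>, and the vertices in \<open>Z\<close>
  are deleted.\<close>

definition step :: "('e \<times> bool) set \<Rightarrow> 'v set \<Rightarrow> (('v \<times> bool) \<times> 'v \<times> bool) set" where
  "step F Z = {((x, i), (y, i)) | x y i. x \<notin> Z \<and> y \<notin> Z \<and> (\<exists>e. link e x y \<and> (e, i) \<notin> F)}
     \<union> {((x, i), (x, \<not> i)) | x i. x \<in> t \<and> x \<notin> Z}"

definition conn :: "('e \<times> bool) set \<Rightarrow> 'v set \<Rightarrow> 'v \<times> bool \<Rightarrow> 'v \<times> bool \<Rightarrow> bool" where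
  "conn F Z a b \<longleftrightarrow> (a, b) \<in> (step F Z)\<^sup>*"

text \<open>A vertex of \<open>t\<close> outside \<open>Z\<close> is a post by its vertical edge;
  longer detours that avoid \<open>Z\<close> count as well.\<close>

definition post :: "('e \<times> bool) set \<Rightarrow> 'v set \<Rightarrow> 'v \<Rightarrow> bool" where
  "post F Z y \<longleftrightarrow> conn F Z (y, False) (y, True)"

definition both_closed :: "('e \<times> bool) set \<Rightarrow> 'e \<Rightarrow> bool" where
  "both_closed F e \<longleftrightarrow> (e, False) \<in> F \<and> (e, True) \<in> F"

text \<open>This makes a swap of levels over \<open>W\<close> harmless: a walk that leaves
  \<open>W\<close> along an open copy of an edge arrives at a vertex where it can change level
  without entering \<open>W\<close> again.\<close>

definition good :: "('e \<times> bool) set \<Rightarrow> 'v set \<Rightarrow> bool" where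
  "good F W \<longleftrightarrow> v \<in> W \<and> W \<subseteq> verts G \<and>
     (\<forall>e x y. link e x y \<and> x \<in> W \<and> y \<notin> W \<and> \<not> both_closed F e \<longrightarrow> post F W y)"

definition core :: "('e \<times> bool) set \<Rightarrow> 'v set" where
  "core F = \<Inter> {W. good F W}"

definition flip :: "'v set \<Rightarrow> ('e \<times> bool) set \<Rightarrow> ('e \<times> bool) set" where
  "flip W F = {(e, i). (e, if e \<in> touching W then \<not> i else i) \<in> F}"

lemma link_sym: "link e x y \<Longrightarrow> link e y x"
  by (auto simp: link_def)

lemma link_verts: "link e x y \<Longrightarrow> x \<in> verts G \<and> y \<in> verts G"
  using ends_in_verts[of e] by (auto simp: link_def)

lemma link_unique: "link e x y \<Longrightarrow> link e x' y' \<Longrightarrow> x' = x \<and> y' = y \<or> x' = y \<and> y' = x"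
  by (auto simp: link_def)

lemma link_exists: "e \<in> edges G \<Longrightarrow> \<exists>x y. link e x y"
  unfolding link_def by (metis uprod_exhaust)

lemma link_touching: "link e x y \<Longrightarrow> e \<in> touching W \<longleftrightarrow> x \<in> W \<or> y \<in> W"
  unfolding touching_def using link_unique link_sym by blast

lemma link_int_edges: "link e x y \<Longrightarrow> e \<in> int_edges W \<longleftrightarrow> x \<in> W \<and> y \<in> W"
  unfolding int_edges_def using link_unique link_sym by blast

lemma link_bd_edges: "link e x y \<Longrightarrow> e \<in> bd_edges W \<longleftrightarrow> (x \<in> W) \<noteq> (y \<in> W)"
  unfolding bd_edges_def using link_unique link_sym by blast

lemma int_edges_subset: "int_edges W \<subseteq> edges G"
  by (auto simp: int_edges_def link_def)

lemma bd_edges_subset: "bd_edges W \<subseteq> edges G"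
  by (auto simp: bd_edges_def link_def)

lemma step_edge:
  "link e x y \<Longrightarrow> (e, i) \<notin> F \<Longrightarrow> x \<notin> Z \<Longrightarrow> y \<notin> Z \<Longrightarrow> ((x, i), (y, i)) \<in> step F Z"
  by (auto simp: step_def)

lemma step_vertical: "x \<in> t \<Longrightarrow> x \<notin> Z \<Longrightarrow> ((x, i), (x, \<not> i)) \<in> step F Z"
  by (auto simp: step_def)

lemma step_cases:
  assumes "(a, b) \<in> step F Z"
  obtains (edge) x y i e where "a = (x, i)" "b = (y, i)" "link e x y" "(e, i) \<notin> F" "x \<notin> Z" "y \<notin> Z"
  | (vertical) x i where "a = (x, i)" "b = (x, \<not> i)" "x \<in> t" "x \<notin> Z"
  using assms unfolding step_def by blast

lemma conn_refl: "conn F Z a a"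
  by (simp add: conn_def)

lemma conn_trans: "conn F Z a b \<Longrightarrow> conn F Z b c \<Longrightarrow> conn F Z a c"
  by (auto simp: conn_def)

lemma conn_step: "(a, b) \<in> step F Z \<Longrightarrow> conn F Z a b"
  by (auto simp: conn_def)

lemma sym_step: "sym (step F Z)"
proof (rule symI, erule step_cases)
  fix a b :: "'v \<times> bool" and x y i e
  assume "a = (x, i)" "b = (y, i)" "link e x y" "(e, i) \<notin> F" "x \<notin> Z" "y \<notin> Z"
  then show "(b, a) \<in> step F Z" by (simp add: step_edge[OF link_sym])
next
  fix a b :: "'v \<times> bool" and x i
  assume "a = (x, i)" "b = (x, \<not> i)" "x \<in> t" "x \<notin> Z"
  then show "(b, a) \<in> step F Z" using step_vertical[of x Z "\<not> i" F] by simp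
qed

lemma conn_sym: "conn F Z a b \<Longrightarrow> conn F Z b a"
  unfolding conn_def using sym_step sym_rtrancl symD by metis

lemma step_mono: "Z' \<subseteq> Z \<Longrightarrow> step F Z \<subseteq> step F Z'"
  by (auto simp: step_def)

lemma conn_mono: "conn F Z a b \<Longrightarrow> Z' \<subseteq> Z \<Longrightarrow> conn F Z' a b"
  unfolding conn_def using rtrancl_mono[OF step_mono] by blast

lemma post_mono: "post F Z y \<Longrightarrow> Z' \<subseteq> Z \<Longrightarrow> post F Z' y"
  unfolding post_def by (rule conn_mono)

lemma post_conn: "post F Z y \<Longrightarrow> conn F Z (y, i) (y, j)"
  unfolding post_def by (cases i; cases j) (auto intro: conn_refl conn_sym)

lemma conn_invariant:
  assumes "conn F Z a b" "a \<in> A" "\<And>c d. c \<in> A \<Longrightarrow> (c, d) \<in> step F Z \<Longrightarrow> d \<in> A"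
  shows "b \<in> A"
  using assms unfolding conn_def by (induction rule: rtrancl_induct) auto

lemma conn_cong:
  assumes "\<And>e x y i. link e x y \<Longrightarrow> x \<notin> Z \<Longrightarrow> y \<notin> Z \<Longrightarrow> (e, i) \<in> F \<longleftrightarrow> (e, i) \<in> F'"
  shows "conn F Z = conn F' Z"
proof -
  have "step F Z \<subseteq> step F' Z" "step F' Z \<subseteq> step F Z"
    using assms by (auto elim!: step_cases intro: step_vertical step_edge)
  then have "step F Z = step F' Z" by blast
  then show ?thesis by (intro ext) (simp add: conn_def)
qed

lemma goodD:
  "good F W \<Longrightarrow> link e x y \<Longrightarrow> x \<in> W \<Longrightarrow> y \<notin> W \<Longrightarrow> (e, i) \<notin> F \<Longrightarrow> post F W y"
  unfolding good_def both_closed_def by (cases i) auto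

lemma good_verts: "good F (verts G)"
  using v_in_verts link_verts by (auto simp: good_def)

text \<open>Good sets are closed under intersection: an edge that leaves the intersection at
  \<open>y\<close> also leaves some good \<open>W\<close> that omits \<open>y\<close>, and a detour
  avoiding \<open>W\<close> avoids the intersection too.\<close>

lemma good_core: "good F (core F)"
  unfolding good_def
proof (intro conjI allI impI)
  show "v \<in> core F" by (auto simp: core_def good_def)
  show "core F \<subseteq> verts G" unfolding core_def using good_verts by blast
  fix e x y assume *: "link e x y \<and> x \<in> core F \<and> y \<notin> core F \<and> \<not> both_closed F e"
  then obtain W where W: "good F W" "y \<notin> W" by (auto simp: core_def)
  then have "x \<in> W" "core F \<subseteq> W" using * by (auto simp: core_def)
  then show "post F (core F) y" using * W post_mono unfolding good_def by meson
qed

lemma core_subset: "good F W \<Longrightarrow> core F \<subseteq> W"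
  by (auto simp: core_def)

lemma v_in_core: "v \<in> core F"
  using good_core by (auto simp: good_def)

section \<open>Swapping the two levels on the edges that meet a vertex set\<close>

lemma flip_flip [simp]: "flip W (flip W F) = F"
  by (auto simp: flip_def)

lemma mem_flip: "link e x y \<Longrightarrow> (e, i) \<in> flip W F \<longleftrightarrow> (e, if x \<in> W \<or> y \<in> W then \<not> i else i) \<in> F"
  by (simp add: flip_def link_touching)

lemma flip_subset: "F \<subseteq> edges G \<times> UNIV \<Longrightarrow> flip W F \<subseteq> edges G \<times> UNIV"
  by (auto simp: flip_def)

lemma card_flip: "card (flip W F) = card F"
proof -
  let ?g = "\<lambda>(e, i). (e, if e \<in> touching W then \<not> i else i)"
  have "flip W F = ?g ` F"
  proof (intro set_eqI iffI)
    fix a assume "a \<in> flip W F"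
    then have "?g a \<in> F" "a = ?g (?g a)" by (auto simp: flip_def split: if_splits)
    then show "a \<in> ?g ` F" by blast
  qed (auto simp: flip_def)
  moreover have "inj_on ?g F" by (rule inj_on_inverseI[of _ ?g]) (simp add: split_def)
  ultimately show ?thesis by (simp only: card_image)
qed

lemma both_closed_flip [simp]: "both_closed (flip W F) e \<longleftrightarrow> both_closed F e"
  by (auto simp: flip_def both_closed_def)

text \<open>Only edges meeting \<open>W\<close> change, and these disappear once the vertices of
  \<open>Z\<close> are deleted.\<close>

lemma conn_flip_avoiding: "W \<subseteq> Z \<Longrightarrow> conn (flip W F) Z = conn F Z"
  by (rule conn_cong) (auto simp: mem_flip subset_iff)

lemma good_flip_superset:
  assumes "good F W" "S \<subseteq> W"
  shows "good (flip S F) W"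
  using assms unfolding good_def post_def conn_flip_avoiding[OF assms(2)] both_closed_flip by blast

text \<open>A walk is translated step by step, exchanging the levels over \<open>W\<close>. Only an
  edge between \<open>W\<close> and its complement causes a mismatch of levels, at its outer
  endpoint, and there goodness supplies a change of level.\<close>

lemma conn_flip:
  assumes good: "good F W" and "Z \<subseteq> W" and "conn F Z (x, i) (y, j)"
  shows "conn (flip W F) Z (x, if x \<in> W then \<not> i else i) (y, if y \<in> W then \<not> j else j)"
proof -
  let ?\<phi> = "\<lambda>(x, i). (x, if x \<in> W then \<not> i else i)"
  have *: "conn (flip W F) Z (?\<phi> a) (?\<phi> b)" if "(a, b) \<in> step F Z" for a b
    using that
  proof (cases rule: step_cases)
    case (edge x y i e)
    have s: "((x, if x \<in> W \<or> y \<in> W then \<not> i else i), (y, if x \<in> W \<or> y \<in> W then \<not> i else i)) \<in> step (flip W F) Z"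
      using edge by (intro step_edge[of e]) (auto simp: mem_flip)
    \<comment> \<open>The detour at the outer endpoint avoids all of \<open>W\<close>, so the flip
      leaves it intact.\<close>
    have p: "post (flip W F) Z z" if "w \<in> W" "z \<notin> W" "link e w z" for w z
      using goodD[OF good that(3,1,2) edge(4)] \<open>Z \<subseteq> W\<close> post_mono
      unfolding post_def by (metis conn_flip_avoiding conn_mono order_refl)
    show ?thesis
    proof (cases "x \<in> W"; cases "y \<in> W")
      assume "x \<in> W" "y \<notin> W"
      then have "conn (flip W F) Z (y, \<not> i) (y, i)" using p edge(3) post_conn by blast
      then show ?thesis using conn_trans[OF conn_step[OF s]] edge \<open>x \<in> W\<close> \<open>y \<notin> W\<close> by simp
    next
      assume "x \<notin> W" "y \<in> W"
      then have "conn (flip W F) Z (x, i) (x, \<not> i)" using p link_sym[OF edge(3)] post_conn by blast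
      then show ?thesis using conn_trans[OF _ conn_step[OF s]] edge \<open>x \<notin> W\<close> \<open>y \<in> W\<close> by simp
    qed (use s edge conn_step in auto)
  next
    case (vertical x i)
    then show ?thesis
      using step_vertical[of x Z i] step_vertical[of x Z "\<not> i"] conn_step by auto
  qed
  have "((x, i), (y, j)) \<in> (step F Z)\<^sup>*" using assms by (simp add: conn_def)
  then have "conn (flip W F) Z (?\<phi> (x, i)) (?\<phi> (y, j))"
    by (rule rtrancl_induct) (blast intro: conn_refl conn_trans *)+
  then show ?thesis by simp
qed

text \<open>The old core stays good after the flip, so the new core lies inside it. Conversely,
  \<open>conn_flip\<close> carries the detours of the new core back to \<open>F\<close>, at worst
  with the two copies of \<open>y\<close> exchanged; so the new core is good for \<open>F\<close>.
  Hence flipping at the core is an involution.\<close>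

lemma core_flip_core: "core (flip (core F) F) = core F"
proof -
  let ?W = "core F" let ?F = "flip (core F) F"
  have gW: "good ?F ?W" by (simp add: good_flip_superset good_core)
  have sub: "core ?F \<subseteq> ?W" by (rule core_subset[OF gW])
  have "good F (core ?F)"
    unfolding good_def
  proof (intro conjI allI impI)
    show "v \<in> core ?F" by (rule v_in_core)
    show "core ?F \<subseteq> verts G" using good_core by (auto simp: good_def)
    fix e x y assume "link e x y \<and> x \<in> core ?F \<and> y \<notin> core ?F \<and> \<not> both_closed F e"
    then have "post ?F (core ?F) y"
      using good_core[of ?F] unfolding good_def by (metis both_closed_flip)
    then have "conn F (core ?F) (y, if y \<in> ?W then \<not> False else False) (y, if y \<in> ?W then \<not> True else True)"
      using conn_flip[OF gW sub, of y False y True] by (simp add: post_def)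
    then show "post F (core ?F) y"
      by (auto simp: post_def dest: conn_sym split: if_splits)
  qed
  then show ?thesis using core_subset sub by blast
qed

text \<open>The target \<open>v\<close> lies in the core and changes level, whereas \<open>u\<close>
  keeps its level.\<close>

lemma conn_flip_core_iff:
  assumes "u \<notin> core F"
  shows "conn (flip (core F) F) {} (u, i) (v, j) \<longleftrightarrow> conn F {} (u, i) (v, \<not> j)"
proof -
  let ?F = "flip (core F) F"
  have g: "good ?F (core F)" by (simp add: good_flip_superset good_core)
  show ?thesis
    using conn_flip[OF good_core, of "{}" F u i v "\<not> j"] conn_flip[OF g, of "{}" u i v j] assms v_in_core
    by auto
qed

subsection \<open>Configurations whose core contains both vertices\<close>

definition wins_same :: "'v \<Rightarrow> ('e \<times> bool) set \<Rightarrow> bool" where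
  "wins_same u F \<longleftrightarrow> conn F {} (u, False) (v, False) \<and> \<not> conn F {} (u, False) (v, True)"

definition wins_cross :: "'v \<Rightarrow> ('e \<times> bool) set \<Rightarrow> bool" where
  "wins_cross u F \<longleftrightarrow> conn F {} (u, False) (v, True) \<and> \<not> conn F {} (u, False) (v, False)"

definition reach :: "'e set \<Rightarrow> 'v set \<Rightarrow> ('v \<times> 'v) set" where
  "reach A W = {(x, y). x \<in> W \<and> y \<in> W \<and> (\<exists>e \<in> A. link e x y)}"

definition inner :: "('e \<times> bool) set \<Rightarrow> 'v set \<Rightarrow> ('e \<times> bool) set" where
  "inner F W = {(e, i) \<in> F. e \<in> int_edges W}"

text \<open>If the two copies of \<open>v\<close> were joined, both events would occur or
  neither.\<close>

lemma not_post_target: "wins_same u F \<or> wins_cross u F \<Longrightarrow> \<not> post F {} v"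
  unfolding wins_same_def wins_cross_def using post_conn conn_trans by blast

text \<open>Minimality of the core: if \<open>w\<close> were a post, the core without
  \<open>w\<close> would still be good, since an edge leaving it ends either at \<open>w\<close> or
  outside the core.\<close>

lemma not_post_core:
  assumes "\<not> post F {} v" "w \<in> core F"
  shows "\<not> post F (core F - {w}) w"
proof
  assume p: "post F (core F - {w}) w"
  then have "w \<noteq> v" using assms post_mono by blast
  have "good F (core F - {w})"
    unfolding good_def
  proof (intro conjI allI impI)
    show "v \<in> core F - {w}" using v_in_core \<open>w \<noteq> v\<close> by auto
    show "core F - {w} \<subseteq> verts G" using good_core by (auto simp: good_def)
    fix e x y assume *: "link e x y \<and> x \<in> core F - {w} \<and> y \<notin> core F - {w} \<and> \<not> both_closed F e"
    show "post F (core F - {w}) y"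
    proof (cases "y = w")
      case False
      then have "post F (core F) y" using * good_core[of F] unfolding good_def by blast
      then show ?thesis by (rule post_mono) blast
    qed (use p in simp)
  qed
  then show False using core_subset assms by blast
qed

text \<open>A core vertex in \<open>t\<close> would be a post by its own vertical edge, against
  minimality.\<close>

lemma core_disjoint_verticals:
  assumes "\<not> post F {} v"
  shows "core F \<inter> t = {}"
proof -
  have "\<not> (w \<in> core F \<and> w \<in> t)" for w
    using not_post_core[OF assms, of w] conn_step[OF step_vertical[of w "core F - {w}" False F]]
    by (auto simp: post_def)
  then show ?thesis by blast
qed

text \<open>If both copies of \<open>e\<close> were open, then going to \<open>y\<close>, changing
  level there outside the core and coming back would make \<open>x\<close> a post, against
  minimality.\<close>

lemma boundary_closed:
  assumes "\<not> post F {} v" "link e x y" "x \<in> core F" "y \<notin> core F"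
  shows "(e, False) \<in> F \<or> (e, True) \<in> F"
proof (rule ccontr)
  assume *: "\<not> ?thesis"
  let ?Z = "core F - {x}"
  have "post F (core F) y" using goodD[OF good_core assms(2-4)] * by blast
  then have "conn F ?Z (y, False) (y, True)" unfolding post_def by (rule conn_mono) blast
  moreover have "conn F ?Z (x, False) (y, False)" "conn F ?Z (y, True) (x, True)"
    using * assms by (auto intro!: conn_step step_edge[of e] link_sym)
  ultimately have "post F ?Z x" unfolding post_def using conn_trans by blast
  then show False using not_post_core assms by blast
qed

lemma conn_reach:
  assumes "(x, y) \<in> (reach A W)\<^sup>*" "\<And>e. e \<in> A \<Longrightarrow> e \<in> int_edges W \<Longrightarrow> (e, i) \<notin> F" "Z \<inter> W = {}"
  shows "conn F Z (x, i) (y, i)"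
  using assms(1)
proof (induction rule: rtrancl_induct)
  case (step y z)
  then obtain e where e: "y \<in> W" "z \<in> W" "e \<in> A" "link e y z" by (auto simp: reach_def)
  then have "e \<in> int_edges W" by (simp add: link_int_edges)
  then have "((y, i), (z, i)) \<in> step F Z" using e assms by (intro step_edge[of e]) auto
  then show ?case using step conn_trans conn_step by blast
qed (rule conn_refl)

lemma reach_subset: "(x, y) \<in> (reach A W)\<^sup>* \<Longrightarrow> x \<in> W \<Longrightarrow> y \<in> W"
  by (induction rule: rtrancl_induct) (auto simp: reach_def)

lemma sym_reach: "sym (reach A W)"
  by (rule symI) (auto simp: reach_def dest: link_sym)

lemma reach_sym: "(x, y) \<in> (reach A W)\<^sup>* \<Longrightarrow> (y, x) \<in> (reach A W)\<^sup>*"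
  using sym_reach sym_rtrancl symD by metis

lemma reach_mono: "A \<subseteq> B \<Longrightarrow> W \<subseteq> W' \<Longrightarrow> (reach A W)\<^sup>* \<subseteq> (reach B W')\<^sup>*"
  by (rule rtrancl_mono) (auto simp: reach_def)

text \<open>The component of \<open>v\<close> in the core, formed with the edges not closed on both
  levels, is already good, so it is the whole core.\<close>

lemma core_connected:
  assumes "w \<in> core F"
  shows "(v, w) \<in> (reach (- {e. both_closed F e}) (core F))\<^sup>*"
proof -
  let ?C = "{w. (v, w) \<in> (reach (- {e. both_closed F e}) (core F))\<^sup>*}"
  have C: "?C \<subseteq> core F" using reach_subset v_in_core by blast
  have "good F ?C"
    unfolding good_def
  proof (intro conjI allI impI)
    show "?C \<subseteq> verts G" using C good_core[of F] by (auto simp: good_def)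
    fix e x y assume *: "link e x y \<and> x \<in> ?C \<and> y \<notin> ?C \<and> \<not> both_closed F e"
    have "y \<notin> core F"
    proof
      assume "y \<in> core F"
      then have "(x, y) \<in> reach (- {e. both_closed F e}) (core F)"
        using * C by (auto simp: reach_def)
      then show False using * rtrancl_into_rtrancl by fastforce
    qed
    then have "post F (core F) y" using * C good_core[of F] unfolding good_def by blast
    then show "post F ?C y" using C by (rule post_mono)
  qed simp
  then show ?thesis using core_subset assms by blast
qed

lemma core_connected_UNIV: "w \<in> core F \<Longrightarrow> (v, w) \<in> (reach UNIV (core F))\<^sup>*"
  using core_connected reach_mono[of _ UNIV] by blast

text \<open>Level 1 of \<open>W\<close> has no exit: there is no open vertical edge over
  \<open>W\<close>, and every boundary edge is closed on that level.\<close>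

lemma isolated_level:
  assumes "W \<inter> t = {}" "\<And>e x y. link e x y \<Longrightarrow> x \<in> W \<Longrightarrow> y \<notin> W \<Longrightarrow> (e, True) \<in> F"
    and "conn F Z (w, True) b" "w \<in> W"
  shows "b \<in> W \<times> {True}"
proof (rule conn_invariant[OF assms(3)])
  fix c d assume "c \<in> W \<times> {True}" and s: "(c, d) \<in> step F Z"
  then obtain x where x: "c = (x, True)" "x \<in> W" by auto
  from s show "d \<in> W \<times> {True}"
    by (cases rule: step_cases) (use x assms in auto)
qed (use assms in auto)

text \<open>Level 1 of \<open>W\<close> is isolated, so no vertex of \<open>W\<close> is a post. The
  core must therefore spread from \<open>v\<close> along the open inner edges until it fills
  \<open>W\<close>. The connection on level 0 runs inside \<open>W\<close>, and the isolation of
  level 1 forbids the cross connection.\<close>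

lemma isolated_core:
  assumes good: "good F W" and "u \<in> W" and t: "W \<inter> t = {}"
    and con: "\<And>w. w \<in> W \<Longrightarrow> (v, w) \<in> (reach UNIV W)\<^sup>*"
    and inner: "inner F W = {}"
    and bd: "\<And>e x y. link e x y \<Longrightarrow> x \<in> W \<Longrightarrow> y \<notin> W \<Longrightarrow> (e, True) \<in> F"
  shows "core F = W" "wins_same u F"
proof -
  have v: "v \<in> W" using good by (simp add: good_def)
  have open_inner: "e \<in> int_edges W \<Longrightarrow> (e, i) \<notin> F" for e i
    using inner by (auto simp: inner_def)
  have no_post: "\<not> post F Z w" if "w \<in> W" for w Z
  proof
    assume "post F Z w"
    then have "conn F Z (w, True) (w, False)" by (rule post_conn)
    from isolated_level[OF t _ this that] bd show False by auto
  qed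
  have "w \<in> core F" if "(v, w) \<in> (reach UNIV W)\<^sup>*" for w
    using that
  proof (induction rule: rtrancl_induct)
    case (step y z)
    then obtain e where e: "link e y z" "y \<in> W" "z \<in> W" by (auto simp: reach_def)
    then have "(e, True) \<notin> F" using open_inner by (simp add: link_int_edges)
    then show ?case using goodD[OF good_core e(1), of F] step no_post e by blast
  qed (rule v_in_core)
  then show "core F = W" using core_subset[OF good] con by blast
  have "conn F {} (v, False) (u, False)"
    using con[OF \<open>u \<in> W\<close>] open_inner by (rule conn_reach) auto
  moreover have "\<not> conn F {} (v, True) (u, False)"
    using isolated_level[OF t _ _ v, of F "{}" "(u, False)"] bd by auto
  ultimately show "wins_same u F"
    unfolding wins_same_def using conn_sym by blast
qed

text \<open>If level 0 were fully open inside the core, a path there from \<open>v\<close> to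
  \<open>u\<close> would produce the same-level event.\<close>

lemma wins_cross_inner:
  assumes "wins_cross u F" "u \<in> core F"
  shows "\<exists>e. (e, False) \<in> inner F (core F)"
proof (rule ccontr)
  assume "\<not> ?thesis"
  then have "conn F {} (v, False) (u, False)"
    by (intro conn_reach[OF core_connected_UNIV[OF assms(2)]]) (auto simp: inner_def)
  then show False using assms(1) conn_sym by (auto simp: wins_cross_def)
qed

definition side :: "'e \<Rightarrow> 'v set \<Rightarrow> 'v set" where
  "side e W = {w. (v, w) \<in> (reach (- {e}) W)\<^sup>*}"

text \<open>After the flip, the old cluster of \<open>(v, 0)\<close>, with its part over the \<open>v\<close>-side of the bridge
  moved up, contains the cluster of \<open>(v, 1)\<close>, while the bridge is now open on level 0.\<close>

lemma bridge_flip: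
  assumes cross: "wins_cross u F" and u: "u \<in> core F" and inner: "inner F (core F) = {(e, False)}"
  defines "F' \<equiv> flip (side e (core F)) F"
  shows "core F' = core F" "inner F' (core F) = {(e, True)}" "wins_same u F'"
proof -
  define W where "W = core F"
  define S where "S = side e W"
  have F': "F' = flip S F" by (simp add: F'_def S_def W_def)
  have v: "v \<in> W" "v \<in> S" using v_in_core by (auto simp: W_def S_def side_def)
  have SW: "S \<subseteq> W" using reach_subset v by (auto simp: S_def side_def)
  have no_post: "\<not> post F {} v" using not_post_target cross by blast
  have Wt: "W \<inter> t = {}" using core_disjoint_verticals[OF no_post] by (simp add: W_def)
  have con: "(v, w) \<in> (reach UNIV W)\<^sup>*" if "w \<in> W" for w
    using core_connected_UNIV that by (simp add: W_def)
  have inner_iff: "(f, i) \<in> F \<longleftrightarrow> f = e \<and> \<not> i" if "f \<in> int_edges W" for f i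
    using inner that by (auto simp: inner_def W_def set_eq_iff)
  have uS: "u \<notin> S"
  proof
    assume "u \<in> S"
    then have "conn F {} (v, False) (u, False)"
      unfolding S_def side_def by (auto intro!: conn_reach[of v u "- {e}" W] simp: inner_iff)
    then show False using cross conn_sym by (auto simp: wins_cross_def)
  qed
  have S_step: "b \<in> S" if "a \<in> S" "b \<in> W" "link f a b" "f \<noteq> e" for a b f
  proof -
    have "(a, b) \<in> reach (- {e}) W" using that SW by (auto simp: reach_def)
    then show ?thesis using that(1) unfolding S_def side_def by (auto intro: rtrancl_into_rtrancl)
  qed
  \<comment> \<open>Otherwise no edge of \<open>W\<close> leaves \<open>S\<close>, and connectedness
    of \<open>W\<close> would put \<open>u\<close> into \<open>S\<close>.\<close>
  have "\<exists>x y. link e x y \<and> x \<in> S \<and> y \<in> W - S"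
  proof (rule ccontr)
    assume *: "\<not> ?thesis"
    have "w \<in> S" if "(v, w) \<in> (reach UNIV W)\<^sup>*" for w
      using that
    proof (induction rule: rtrancl_induct)
      case (step a b)
      then obtain f where f: "link f a b" "b \<in> W" by (auto simp: reach_def)
      then show ?case using step.IH S_step[of a b f] * by blast
    qed (rule v)
    then show False using con u uS by (auto simp: W_def)
  qed
  then obtain x y where xy: "link e x y" "x \<in> S" "y \<in> W - S" by blast
  have e_int: "e \<in> int_edges W" using xy SW by (auto simp: link_int_edges)
  have far: "w \<in> S \<or> (y, w) \<in> (reach (- {e}) (W - S))\<^sup>*" if "(v, w) \<in> (reach UNIV W)\<^sup>*" for w
    using that
  proof (induction rule: rtrancl_induct)
    case (step a b)
    then obtain f where f: "link f a b" "a \<in> W" "b \<in> W" by (auto simp: reach_def)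
    show ?case
    proof (cases "b \<in> S")
      case False
      show ?thesis
      proof (cases "f = e")
        case True
        then show ?thesis using link_unique[OF xy(1)] f False xy by blast
      next
        case ne: False
        then have "a \<notin> S" using S_step f False by blast
        then have "(a, b) \<in> reach (- {e}) (W - S)" using f ne False by (auto simp: reach_def)
        then show ?thesis using step.IH \<open>a \<notin> S\<close> by (auto intro: rtrancl_into_rtrancl)
      qed
    qed simp
  qed (use v in simp)
  have far_conn: "conn F S (y, i) (w, i)" if "w \<in> W - S" for w i
  proof (rule conn_reach)
    show "(y, w) \<in> (reach (- {e}) (W - S))\<^sup>*" using far[OF con] that by blast
    fix f assume "f \<in> - {e}" "f \<in> int_edges (W - S)"
    then have "f \<in> int_edges W" "f \<noteq> e" by (auto simp: int_edges_def)
    then show "(f, i) \<notin> F" by (simp add: inner_iff)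
  qed blast
  have far_conn0: "conn F {} (y, i) (w, i)" if "w \<in> W - S" for w i
    using far_conn[OF that] by (rule conn_mono) simp

  \<comment> \<open>Over \<open>W\<close>, the cluster of (v,0) meets only level 0 of
    \<open>S\<close>. Level 1 is fully open inside \<open>W\<close>, so reaching it would make
    \<open>v\<close> a post; reaching level 0 beyond the bridge would give access to (u,0).\<close>
  have M: "w \<in> S \<and> \<not> i" if m: "conn F {} (v, False) (w, i)" and w: "w \<in> W" for w i
  proof -
    have "\<not> i"
    proof
      assume i
      have "conn F {} (v, True) (w, True)"
        using con[OF w] by (rule conn_reach) (auto simp: inner_iff)
      moreover have "conn F {} (v, False) (w, True)" using m \<open>i\<close> by simp
      ultimately have "post F {} v" unfolding post_def using conn_sym conn_trans by blast
      then show False using no_post by blast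
    qed
    moreover have "w \<in> S"
    proof (rule ccontr)
      assume "w \<notin> S"
      then have "conn F {} (w, False) (u, False)"
        using conn_trans[OF conn_sym[OF far_conn0[of w False]] far_conn0[of u False]] w u uS
        by (simp add: W_def)
      moreover have "conn F {} (v, False) (w, False)" using m \<open>\<not> i\<close> by simp
      ultimately have "conn F {} (u, False) (v, False)" using conn_sym conn_trans by blast
      then show False using cross by (simp add: wins_cross_def)
    qed
    ultimately show ?thesis by blast
  qed
  define M' where "M' = {(z, i). conn F {} (v, False) (z, if z \<in> S then \<not> i else i)}"
  \<comment> \<open>The delicate steps cross the boundary of \<open>S\<close>. There
    \<open>M\<close> forces the endpoint outside \<open>S\<close> out of \<open>W\<close>, where
    goodness of the core allows the change of level.\<close>
  have closed: "d \<in> M'" if c: "c \<in> M'" and s: "(c, d) \<in> step F' {}" for c d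
    using s
  proof (cases rule: step_cases)
    case (vertical a i)
    then have "a \<notin> S" using Wt SW by blast
    moreover have "conn F {} (a, i) (a, \<not> i)" using vertical by (intro conn_step step_vertical) auto
    ultimately show ?thesis
      using c vertical conn_trans[of F "{}" "(v, False)" "(a, i)" "(a, \<not> i)"] by (simp add: M'_def)
  next
    case (edge a b i f)
    have s: "conn F {} (a, j) (b, j)" if "(f, j) \<notin> F" for j
      using that edge by (intro conn_step step_edge) auto
    have outer: "conn F {} (z, j) (z, k)" if "z' \<in> S" "z \<notin> W" "link f z' z" "(f, l) \<notin> F" for z z' j k l
    proof -
      have "post F W z" using goodD[OF good_core that(3), of F l] that SW unfolding W_def by blast
      then show ?thesis using post_mono post_conn by blast
    qed
    show ?thesis
    proof (cases "a \<in> S"; cases "b \<in> S")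
      assume ab: "a \<in> S" "b \<notin> S"
      then have f: "(f, \<not> i) \<notin> F" using edge by (simp add: F' mem_flip)
      have m: "conn F {} (v, False) (b, \<not> i)"
        using c ab conn_trans[OF _ s[OF f]] edge by (simp add: M'_def)
      then have "b \<notin> W" using M ab by blast
      then have "conn F {} (b, \<not> i) (b, i)" using outer ab edge f by blast
      from conn_trans[OF m this] show ?thesis using ab edge by (simp add: M'_def)
    next
      assume ab: "a \<notin> S" "b \<in> S"
      then have f: "(f, \<not> i) \<notin> F" using edge by (simp add: F' mem_flip)
      have m: "conn F {} (v, False) (a, i)"
        using c ab edge by (simp add: M'_def)
      then have "a \<notin> W" using M ab by blast
      then have "conn F {} (a, i) (a, \<not> i)" using outer ab link_sym[OF edge(3)] f by blast
      from conn_trans[OF conn_trans[OF m this] s[OF f]] show ?thesis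
        using ab edge by (simp add: M'_def)
    next
      assume ab: "a \<in> S" "b \<in> S"
      then have "(f, \<not> i) \<notin> F" using edge by (simp add: F' mem_flip)
      then show ?thesis using c ab edge conn_trans[OF _ s] by (simp add: M'_def)
    next
      assume ab: "a \<notin> S" "b \<notin> S"
      then have "(f, i) \<notin> F" using edge by (simp add: F' mem_flip)
      then show ?thesis using c ab edge conn_trans[OF _ s] by (simp add: M'_def)
    qed
  qed
  have M': "b \<in> M'" if "conn F' {} (v, True) b" for b
    using that by (rule conn_invariant) (use v closed in \<open>auto simp: M'_def conn_refl\<close>)

  have "e \<in> touching S" using xy by (simp add: link_touching)
  then have "(f, i) \<in> F' \<longleftrightarrow> f = e \<and> i" if "f \<in> int_edges W" for f i
    using that inner_iff[OF that] by (cases "f = e") (simp_all add: F' flip_def)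
  then show inner': "inner F' (core F) = {(e, True)}"
    using e_int unfolding W_def[symmetric] by (auto simp: inner_def)
  have inner'_iff: "(f, i) \<in> F' \<longleftrightarrow> f = e \<and> i" if "f \<in> int_edges W" for f i
    using inner' that by (auto simp: inner_def W_def set_eq_iff)
  have "conn F' {} (v, False) (u, False)"
    using con[of u] u by (intro conn_reach[of v u UNIV W]) (auto simp: inner'_iff W_def)
  moreover have "\<not> conn F' {} (v, True) (u, False)"
    using M'[of "(u, False)"] M[of u False] u uS by (auto simp: M'_def W_def)
  ultimately show "wins_same u F'"
    unfolding wins_same_def using conn_sym by blast

  have good': "good F' W"
    unfolding F' W_def using SW by (intro good_flip_superset good_core) (simp add: W_def)
  \<comment> \<open>Such a post would bring (s,0) into the new cluster of (v,1), hence (s,1) into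
    the old cluster of (v,0), which \<open>M\<close> excludes.\<close>
  have no_post_S: "\<not> post F' Z s" if "s \<in> S" for s Z
  proof
    assume "post F' Z s"
    then have "conn F' {} (s, True) (s, False)" using post_mono post_conn by blast
    moreover have "conn F' {} (v, True) (s, True)"
      using that by (intro conn_reach[of v s "- {e}" W]) (auto simp: inner'_iff S_def side_def)
    ultimately have "(s, False) \<in> M'" using M' conn_trans by blast
    then have "conn F {} (v, False) (s, True)" using that by (simp add: M'_def)
    then show False using M that SW by blast
  qed
  \<comment> \<open>Goodness propagates membership: an open edge from the core to a vertex that is
    not a post cannot leave the core. This fills \<open>S\<close> first, then crosses
    \<open>e\<close> on level 0 and fills the far side.\<close>
  have "s \<in> core F'" if "(v, s) \<in> (reach (- {e}) W)\<^sup>*" for s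
    using that
  proof (induction rule: rtrancl_induct)
    case (step a b)
    then obtain f where f: "link f a b" "a \<in> W" "b \<in> W" "f \<noteq> e" by (auto simp: reach_def)
    have "b \<in> S" using step.hyps unfolding S_def side_def by (auto intro: rtrancl_into_rtrancl)
    moreover have "(f, True) \<notin> F'" using f by (simp add: inner'_iff link_int_edges)
    ultimately show ?case using goodD[OF good_core f(1), of F'] step.IH no_post_S by blast
  qed (rule v_in_core)
  then have S_core: "S \<subseteq> core F'" by (auto simp: S_def side_def)
  \<comment> \<open>A post beyond the bridge would make \<open>y\<close> a post of \<open>F\<close>
    outside \<open>S\<close>, so that \<open>S\<close> itself would be good for \<open>F\<close>;
    but \<open>S\<close> omits \<open>u\<close>, which lies in the core.\<close>
  have no_post_far: "\<not> post F' (core F') b" if b: "b \<in> W - S" for b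
  proof
    assume "post F' (core F') b"
    then have "post F' S b" using S_core post_mono by blast
    then have "post F S b" by (simp add: post_def F' conn_flip_avoiding)
    then have y: "post F S y"
      using far_conn[OF b] conn_sym conn_trans unfolding post_def by blast
    have "good F S"
      unfolding good_def
    proof (intro conjI allI impI)
      show "S \<subseteq> verts G" using SW good_core[of F] by (auto simp: good_def W_def)
      fix f a z assume *: "link f a z \<and> a \<in> S \<and> z \<notin> S \<and> \<not> both_closed F f"
      show "post F S z"
      proof (cases "z \<in> W")
        case True
        then have "f = e" using S_step * by blast
        then have "z = y" using link_unique[OF xy(1)] * xy by blast
        then show ?thesis using y by simp
      next
        case False
        then have "post F W z" using * SW good_core[of F] unfolding good_def W_def by blast
        then show ?thesis using SW post_mono by blast
      qed
    qed (rule v)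
    then show False using core_subset u uS by blast
  qed
  have "w \<in> core F'" if "(y, w) \<in> (reach (- {e}) (W - S))\<^sup>*" for w
    using that
  proof (induction rule: rtrancl_induct)
    case base
    have "(e, False) \<notin> F'" using e_int by (simp add: inner'_iff)
    then show ?case using goodD[OF good_core xy(1), of F'] S_core xy no_post_far by blast
  next
    case (step a b)
    then obtain f where f: "link f a b" "a \<in> W - S" "b \<in> W - S" "f \<noteq> e" by (auto simp: reach_def)
    then have "(f, True) \<notin> F'" by (simp add: inner'_iff link_int_edges)
    then show ?case using goodD[OF good_core f(1), of F'] step.IH no_post_far f by blast
  qed
  then have "W \<subseteq> core F'" using far con S_core by blast
  then show "core F' = core F" using core_subset[OF good'] by (simp add: W_def)
qed

subsection \<open>Comparing the total weights\<close>

lemma edge_trichotomy: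
  assumes "e \<in> edges G"
  shows "e \<in> int_edges W \<or> e \<in> bd_edges W \<or> e \<notin> touching W"
  using link_exists[OF assms] link_int_edges link_bd_edges link_touching by metis

lemma bd_not_int: "e \<in> bd_edges W \<Longrightarrow> e \<notin> int_edges W"
  unfolding bd_edges_def using link_int_edges by blast

lemma touching_iff: "e \<in> touching W \<longleftrightarrow> e \<in> int_edges W \<or> e \<in> bd_edges W"
  by (auto simp: int_edges_def bd_edges_def touching_def)

text \<open>Level 1 is closed on the whole boundary. By \<open>boundary_closed\<close> this moves
  closures between levels without adding any in the configurations to which it is applied.\<close>

definition straighten :: "'v set \<Rightarrow> ('e \<times> bool) set \<Rightarrow> ('e \<times> bool) set" where
  "straighten W F = {(e, i) \<in> F. e \<notin> touching W} \<union> {(e, i). e \<in> bd_edges W \<and> (i \<or> both_closed F e)}"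

lemma straighten_subset: "F \<subseteq> edges G \<times> UNIV \<Longrightarrow> straighten W F \<subseteq> edges G \<times> UNIV"
  using bd_edges_subset by (auto simp: straighten_def)

text \<open>Edges away from the core and double closures on its boundary are kept, so the core stays
  good; its level 1 becomes isolated, and \<open>isolated_core\<close> applies.\<close>

lemma straighten_core:
  assumes "\<not> post F {} v" "u \<in> core F"
  shows "core (straighten (core F) F) = core F" "wins_same u (straighten (core F) F)"
    and "inner (straighten (core F) F) (core F) = {}"
proof -
  let ?W = "core F" let ?F = "straighten (core F) F"
  show inner: "inner ?F ?W = {}"
    by (auto simp: inner_def straighten_def touching_iff dest: bd_not_int)
  have off: "conn ?F ?W = conn F ?W"
    by (rule conn_cong) (auto simp: straighten_def link_touching link_bd_edges)
  have good: "good ?F ?W"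
    unfolding good_def
  proof (intro conjI allI impI)
    show "v \<in> ?W" by (rule v_in_core)
    show "?W \<subseteq> verts G" using good_core by (auto simp: good_def)
    fix e x y assume *: "link e x y \<and> x \<in> ?W \<and> y \<notin> ?W \<and> \<not> both_closed ?F e"
    then have "\<not> both_closed F e"
      by (auto simp: both_closed_def straighten_def link_bd_edges)
    then have "post F ?W y" using * good_core[of F] unfolding good_def by blast
    then show "post ?F ?W y" by (simp add: post_def off)
  qed
  have bd: "(e, True) \<in> ?F" if "link e x y" "x \<in> ?W" "y \<notin> ?W" for e x y
    using that by (simp add: straighten_def link_bd_edges)
  show "core ?F = ?W" "wins_same u ?F"
    using isolated_core[OF good assms(2) core_disjoint_verticals[OF assms(1)] _ inner] core_connected_UNIV bd
    by blast+
qed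

text \<open>Only the closures inside the core are lost. Those on the boundary are moved to level 1
  injectively, because only an edge closed on a single level is moved.\<close>

lemma card_straighten:
  assumes fin: "finite F" and sub: "F \<subseteq> edges G \<times> UNIV" and "\<not> post F {} v"
  shows "card F = card (straighten (core F) F) + card (inner F (core F))"
proof -
  let ?W = "core F"
  let ?D = "\<lambda>e. e \<in> bd_edges ?W \<and> \<not> both_closed F e"
  let ?g = "\<lambda>(e, i). (e, i \<or> ?D e)"
  have one: "(e, False) \<in> F \<or> (e, True) \<in> F" if "e \<in> bd_edges ?W" for e
    using that boundary_closed[OF assms(3)] by (auto simp: bd_edges_def)
  have img: "?g ` (F - inner F ?W) = straighten ?W F"
  proof (intro set_eqI iffI)
    fix a assume "a \<in> ?g ` (F - inner F ?W)"
    then obtain e i where "a = ?g (e, i)" "(e, i) \<in> F" "e \<notin> int_edges ?W" by (auto simp: inner_def)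
    then show "a \<in> straighten ?W F"
      using edge_trichotomy[of e ?W] sub
      by (cases "e \<in> bd_edges ?W"; cases i) (auto simp: straighten_def touching_iff)
  next
    fix a assume "a \<in> straighten ?W F"
    moreover obtain e i where a: "a = (e, i)" by fastforce
    ultimately consider "(e, i) \<in> F" "e \<notin> touching ?W" | "e \<in> bd_edges ?W" "both_closed F e"
      | "?D e" "i" by (auto simp: straighten_def)
    then show "a \<in> ?g ` (F - inner F ?W)"
    proof cases
      case 1
      then have "?g (e, i) = a" "(e, i) \<in> F - inner F ?W" by (auto simp: a inner_def touching_iff)
      then show ?thesis by (metis (no_types, lifting) image_eqI)
    next
      case 2
      then have "?g (e, i) = a" "(e, i) \<in> F - inner F ?W"
        by (cases i; auto simp: a inner_def both_closed_def dest: bd_not_int)+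
      then show ?thesis by (metis (no_types, lifting) image_eqI)
    next
      case 3
      then obtain j where "(e, j) \<in> F" using one by blast
      then have "?g (e, j) = a" "(e, j) \<in> F - inner F ?W"
        using 3 by (auto simp: a inner_def dest: bd_not_int)
      then show ?thesis by (metis (no_types, lifting) image_eqI)
    qed
  qed
  have "inj_on ?g (F - inner F ?W)"
  proof (rule inj_onI)
    fix a b assume ab: "a \<in> F - inner F ?W" "b \<in> F - inner F ?W" "?g a = ?g b"
    obtain e i f j where a: "a = (e, i)" and b: "b = (f, j)" by fastforce
    then have *: "(e, i) \<in> F" "(e, j) \<in> F" "(i \<or> ?D e) = (j \<or> ?D e)" "f = e"
      using ab by auto
    have "i = j"
      using * by (cases i; cases j) (auto simp: both_closed_def)
    then show "a = b" using a b * by simp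
  qed
  then have "card (straighten ?W F) = card (F - inner F ?W)"
    unfolding img[symmetric] by (rule card_image)
  moreover have "inner F ?W \<subseteq> F" by (auto simp: inner_def)
  ultimately show ?thesis
    using fin by (simp add: card_Diff_subset finite_subset card_mono)
qed

text \<open>Undoes straightening: \<open>I\<close> restores the closed inner edges, and
  \<open>B\<close> is the set of boundary edges that were closed on level 0. A boundary edge closed
  on level 0 in \<open>A\<close> was closed on both levels.\<close>

definition recover :: "'v set \<Rightarrow> ('e \<times> bool) set \<Rightarrow> ('e \<times> bool) set \<Rightarrow> 'e set \<Rightarrow> ('e \<times> bool) set" where
  "recover W A I B = {(e, i) \<in> A. e \<notin> touching W} \<union> I \<union>
     {(e, i). e \<in> bd_edges W \<and> (if i then e \<notin> B \<or> (e, False) \<in> A else e \<in> B)}"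

lemma recover_straighten:
  assumes "\<not> post F {} v" "F \<subseteq> edges G \<times> UNIV"
  shows "recover (core F) (straighten (core F) F) (inner F (core F)) {e \<in> bd_edges (core F). (e, False) \<in> F} = F"
    (is "?R = F")
proof -
  have "(e, i) \<in> ?R \<longleftrightarrow> (e, i) \<in> F" for e i
  proof (cases "e \<in> bd_edges (core F)")
    case True
    then have "(e, False) \<in> F \<or> (e, True) \<in> F"
      using boundary_closed[OF assms(1)] by (auto simp: bd_edges_def)
    then show ?thesis
      using True bd_not_int[OF True]
      by (cases i) (auto simp: recover_def touching_iff inner_def straighten_def both_closed_def)
  next
    case False
    then show ?thesis
      using assms(2) edge_trichotomy[of e "core F"]
      by (auto simp: recover_def inner_def straighten_def touching_iff)
  qed
  then show ?thesis by auto
qed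

section \<open>Weighted sums over configurations\<close>

lemma finite_configs: "finite (Pow (edges G \<times> (UNIV :: bool set)))"
  using finite_edges by simp

text \<open>With r = (1 - p)/p this is the difference of the two conditional probabilities, up to a
  positive factor.\<close>

definition weight_diff :: "real \<Rightarrow> 'v \<Rightarrow> real" where
  "weight_diff r u = (\<Sum>F\<in>Pow (edges G \<times> UNIV). r ^ card F *
     (of_bool (conn F {} (u, False) (v, False)) - of_bool (conn F {} (u, False) (v, True))))"

definition configs :: "'v \<Rightarrow> ('e \<times> bool) set set" where
  "configs u = {F. F \<subseteq> edges G \<times> UNIV \<and> u \<in> core F}"

text \<open>Where \<open>u\<close> is outside the core, the core flip preserves weights and reverses
  the sign of the summand, so that part of the sum equals its own negative. In the rest,
  configurations with both events or neither contribute 0.\<close>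

lemma weight_diff_core:
  "weight_diff r u =
    (\<Sum>F | F \<in> configs u \<and> wins_same u F. r ^ card F) - (\<Sum>F | F \<in> configs u \<and> wins_cross u F. r ^ card F)"
proof -
  let ?f = "\<lambda>F. r ^ card F *
     (of_bool (conn F {} (u, False) (v, False)) - of_bool (conn F {} (u, False) (v, True)))"
  let ?P = "Pow (edges G \<times> (UNIV :: bool set))"
  let ?\<phi> = "\<lambda>F. flip (core F) F"
  have fin: "finite (configs u)"
    using finite_configs by (auto simp: configs_def intro: finite_subset[rotated])
  have "sum ?f (?P - configs u) = sum (\<lambda>F. ?f (?\<phi> F)) (?P - configs u)"
    by (rule sum.reindex_bij_witness[of _ ?\<phi> ?\<phi>])
      (auto simp: core_flip_core configs_def dest: flip_subset[THEN subsetD, rotated])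
  also have "\<dots> = sum (\<lambda>F. - ?f F) (?P - configs u)"
  proof (rule sum.cong)
    fix F assume "F \<in> ?P - configs u"
    then have "u \<notin> core F" by (auto simp: configs_def)
    then show "?f (?\<phi> F) = - ?f F"
      by (simp add: conn_flip_core_iff card_flip algebra_simps)
  qed simp
  finally have "sum ?f (?P - configs u) = 0" by (simp add: sum_negf)
  then have "weight_diff r u = sum ?f (configs u)"
    unfolding weight_diff_def using finite_configs
    by (subst sum.subset_diff[of "configs u"]) (auto simp: configs_def)
  also have "\<dots> = (\<Sum>F\<in>configs u. (if wins_same u F then r ^ card F else 0) - (if wins_cross u F then r ^ card F else 0))"
    by (rule sum.cong) (auto simp: wins_same_def wins_cross_def)
  finally show ?thesis
    using fin by (simp add: sum_subtractf sum.inter_filter)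
qed

lemma wins_cross_single:
  assumes "wins_cross u F" "u \<in> core F" "card (inner F (core F)) = 1"
  obtains e where "inner F (core F) = {(e, False)}"
  using wins_cross_inner[OF assms(1,2)] assms(3) by (auto simp: card_1_singleton_iff)

text \<open>The flip of \<open>bridge_flip\<close> preserves weights. It is injective because the
  core and the bridge can be read off from the image, so the flip can be undone.\<close>

lemma sum_single_inner_le:
  fixes r :: real
  assumes "0 < r"
  shows "(\<Sum>F | F \<in> configs u \<and> wins_cross u F \<and> card (inner F (core F)) = 1. r ^ card F)
    \<le> (\<Sum>F | F \<in> configs u \<and> wins_same u F \<and> card (inner F (core F)) = 1. r ^ card F)"
    (is "sum ?w ?Y \<le> sum ?w ?X")
proof -
  define h where "h F = flip (side (fst (the_elem (inner F (core F)))) (core F)) F" for F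
  have h: "core (h F) = core F \<and> wins_same u (h F) \<and>
      (\<exists>e. inner F (core F) = {(e, False)} \<and> inner (h F) (core F) = {(e, True)})" if F: "F \<in> ?Y" for F
  proof -
    obtain e where e: "inner F (core F) = {(e, False)}"
      using F wins_cross_single[of u F] by (auto simp: configs_def)
    then show ?thesis
      using bridge_flip[of u F e] F by (simp add: h_def configs_def)
  qed
  have inj: "inj_on h ?Y"
  proof (rule inj_onI)
    fix F1 F2 assume F: "F1 \<in> ?Y" "F2 \<in> ?Y" "h F1 = h F2"
    then have c: "core F1 = core F2" using h[OF F(1)] h[OF F(2)] by simp
    then have i: "inner F1 (core F1) = inner F2 (core F2)" using h[OF F(1)] h[OF F(2)] F(3) by auto
    have "F1 = flip (side (fst (the_elem (inner F1 (core F1)))) (core F1)) (h F1)" by (simp add: h_def)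
    also have "\<dots> = flip (side (fst (the_elem (inner F2 (core F2)))) (core F2)) (h F2)"
      using c i F(3) by simp
    also have "\<dots> = F2" by (simp add: h_def)
    finally show "F1 = F2" .
  qed
  have "sum ?w ?Y = sum (\<lambda>F. ?w (h F)) ?Y" by (simp add: h_def card_flip)
  also have "\<dots> = sum ?w (h ` ?Y)" using inj by (simp add: sum.reindex)
  also have "\<dots> \<le> sum ?w ?X"
  proof (rule sum_mono2[where f = ?w])
    show "finite ?X"
      using finite_configs by (auto simp: configs_def intro: finite_subset[rotated])
    show "h ` ?Y \<subseteq> ?X"
    proof
      fix F' assume "F' \<in> h ` ?Y"
      then obtain F where F: "F \<in> ?Y" "F' = h F" by blast
      then have "F' \<subseteq> edges G \<times> UNIV"
        by (simp add: h_def configs_def flip_subset)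
      then show "F' \<in> ?X" using h[OF F(1)] F by (auto simp: configs_def)
    qed
  qed (use assms in simp)
  finally show ?thesis .
qed

text \<open>Total weight, relative to a straightened configuration, of the data for
  \<open>recover\<close>: any set of boundary edges and at least two closed copies of inner
  edges.\<close>

definition excess :: "real \<Rightarrow> 'v set \<Rightarrow> real" where
  "excess r W = 2 ^ card (bd_edges W) * ((1 + r) ^ (2 * card (int_edges W)) - 1 - 2 * real (card (int_edges W)) * r)"

text \<open>A configuration is encoded by its straightening, its closed inner edges and its boundary
  edges closed on level 0; \<open>recover\<close> shows that nothing is lost. The weight factors
  accordingly, and summing over all conceivable triples gives the bound.\<close>

lemma sum_multiple_inner_le:
  fixes r :: real
  assumes "0 < r"
  shows "(\<Sum>F | F \<in> configs u \<and> wins_cross u F \<and> 2 \<le> card (inner F (core F)). r ^ card F)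
    \<le> (\<Sum>F | F \<in> configs u \<and> wins_same u F \<and> inner F (core F) = {}. r ^ card F * excess r (core F))"
    (is "sum _ ?Y \<le> sum _ ?X")
proof -
  let ?S = "\<lambda>F. straighten (core F) F"
  let ?I = "\<lambda>W. {I. I \<subseteq> int_edges W \<times> (UNIV :: bool set) \<and> 2 \<le> card I}"
  define h where "h F = (?S F, inner F (core F), {e \<in> bd_edges (core F). (e, False) \<in> F})" for F
  let ?k = "\<lambda>(F, I, B :: 'e set). r ^ card F * r ^ card I"
  have Y: "F \<subseteq> edges G \<times> UNIV" "finite F" "\<not> post F {} v" "u \<in> core F" if "F \<in> ?Y" for F
    using that not_post_target finite_edges finite_subset[of F "edges G \<times> UNIV"]
    by (auto simp: configs_def)
  have fin_int: "finite (int_edges W \<times> (UNIV :: bool set))" and fin_bd: "finite (bd_edges W)" for W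
    using finite_subset[OF int_edges_subset finite_edges] finite_subset[OF bd_edges_subset finite_edges]
    by simp_all
  have fin_I: "finite (?I W)" for W
    using fin_int by (auto intro: finite_subset[of _ "Pow (int_edges W \<times> UNIV)"])
  have fin_X: "finite ?X"
    using finite_configs by (auto simp: configs_def intro: finite_subset[rotated])
  have inj: "inj_on h ?Y"
  proof (rule inj_onI)
    fix F1 F2 assume F: "F1 \<in> ?Y" "F2 \<in> ?Y" "h F1 = h F2"
    then have s: "?S F1 = ?S F2" and i: "inner F1 (core F1) = inner F2 (core F2)"
      and b: "{e \<in> bd_edges (core F1). (e, False) \<in> F1} = {e \<in> bd_edges (core F2). (e, False) \<in> F2}"
      by (simp_all add: h_def)
    have c: "core F1 = core F2"
      using straighten_core(1)[OF Y(3,4)[OF F(1)]] straighten_core(1)[OF Y(3,4)[OF F(2)]] s by simp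
    show "F1 = F2"
      using recover_straighten[OF Y(3,1)[OF F(1)]] recover_straighten[OF Y(3,1)[OF F(2)]]
      unfolding s i b unfolding c by simp
  qed
  have "(\<Sum>F\<in>?Y. r ^ card F) = (\<Sum>F\<in>?Y. ?k (h F))"
  proof (rule sum.cong[OF refl])
    fix F assume "F \<in> ?Y"
    then show "r ^ card F = ?k (h F)"
      using card_straighten[OF Y(2,1,3)] by (simp only: h_def prod.case power_add)
  qed
  also have "\<dots> = sum ?k (h ` ?Y)" using inj by (simp add: sum.reindex)
  also have "\<dots> \<le> sum ?k (SIGMA F:?X. ?I (core F) \<times> Pow (bd_edges (core F)))"
  proof (rule sum_mono2)
    show "finite (SIGMA F:?X. ?I (core F) \<times> Pow (bd_edges (core F)))"
      using fin_X fin_I fin_bd by (intro finite_SigmaI finite_cartesian_product) auto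
    show "h ` ?Y \<subseteq> (SIGMA F:?X. ?I (core F) \<times> Pow (bd_edges (core F)))"
    proof
      fix z assume "z \<in> h ` ?Y"
      then obtain F where F: "F \<in> ?Y" "z = h F" by blast
      have "?S F \<in> ?X"
        using straighten_core[OF Y(3,4)[OF F(1)]] straighten_subset[OF Y(1)[OF F(1)]] Y(4)[OF F(1)]
        by (simp add: configs_def)
      moreover have "core (?S F) = core F" using straighten_core(1)[OF Y(3,4)[OF F(1)]] .
      ultimately show "z \<in> (SIGMA F:?X. ?I (core F) \<times> Pow (bd_edges (core F)))"
        using F by (auto simp: h_def inner_def)
    qed
  qed (use assms in auto)
  also have "\<dots> = (\<Sum>F\<in>?X. \<Sum>(I, B)\<in>?I (core F) \<times> Pow (bd_edges (core F)). r ^ card F * r ^ card I)"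
    using fin_X fin_I fin_bd by (subst sum.Sigma) (auto simp: split_def)
  also have "\<dots> = (\<Sum>F\<in>?X. r ^ card F * excess r (core F))"
  proof (rule sum.cong[OF refl])
    fix F
    have "(\<Sum>(I, B)\<in>?I (core F) \<times> Pow (bd_edges (core F)). r ^ card F * r ^ card I)
        = (\<Sum>I\<in>?I (core F). \<Sum>B\<in>Pow (bd_edges (core F)). r ^ card F * r ^ card I)"
      by (rule sum.cartesian_product[symmetric])
    also have "\<dots> = r ^ card F * (2 ^ card (bd_edges (core F)) * (\<Sum>I\<in>?I (core F). r ^ card I))"
      using fin_bd by (simp add: card_Pow sum_distrib_left mult_ac)
    also have "\<dots> = r ^ card F * excess r (core F)"
      unfolding sum_power_card_ge_2[OF fin_int] by (simp add: excess_def card_cartesian_product mult.commute)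
    finally show "(\<Sum>(I, B)\<in>?I (core F) \<times> Pow (bd_edges (core F)). r ^ card F * r ^ card I)
        = r ^ card F * excess r (core F)" .
  qed
  finally show ?thesis .
qed

text \<open>Crossing configurations with one closed inner edge are paid for by same-level ones of
  the same kind, the others by a fraction \<open>excess\<close> < 1 of the members of
  \<open>X\<close>. Each member of \<open>X\<close> thus leaves a positive surplus.\<close>

lemma weight_diff_sign:
  fixes r :: real and u :: 'v
  assumes r: "0 < r" and ex: "\<And>W. excess r W < 1"
  defines "X \<equiv> {F. F \<in> configs u \<and> wins_same u F \<and> inner F (core F) = {}}"
  shows "weight_diff r u \<ge> 0" "weight_diff r u > 0 \<longleftrightarrow> X \<noteq> {}"
proof -
  let ?w = "\<lambda>F :: ('e \<times> bool) set. r ^ card F"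
  let ?S = "{F. F \<in> configs u \<and> wins_same u F}" and ?C = "{F. F \<in> configs u \<and> wins_cross u F}"
  let ?S1 = "{F. F \<in> configs u \<and> wins_same u F \<and> card (inner F (core F)) = 1}"
  let ?C1 = "{F. F \<in> configs u \<and> wins_cross u F \<and> card (inner F (core F)) = 1}"
  let ?C2 = "{F. F \<in> configs u \<and> wins_cross u F \<and> 2 \<le> card (inner F (core F))}"
  have fin: "finite (configs u)"
    using finite_configs by (auto simp: configs_def intro: finite_subset[rotated])
  have "?C \<subseteq> ?C1 \<union> ?C2"
  proof
    fix F assume F: "F \<in> ?C"
    then have "finite (inner F (core F))"
      using finite_edges finite_subset[of "inner F (core F)" "edges G \<times> UNIV"]
      by (auto simp: configs_def inner_def)
    moreover have "inner F (core F) \<noteq> {}" using wins_cross_inner[of u F] F by (auto simp: configs_def)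
    ultimately have "card (inner F (core F)) > 0" by (simp add: card_gt_0_iff)
    then show "F \<in> ?C1 \<union> ?C2" using F by auto
  qed
  then have "?C = ?C1 \<union> ?C2" by auto
  moreover have "sum ?w (?C1 \<union> ?C2) = sum ?w ?C1 + sum ?w ?C2"
    using fin by (intro sum.union_disjoint) auto
  ultimately have C: "sum ?w ?C = sum ?w ?C1 + sum ?w ?C2" by simp
  have "sum ?w X + sum ?w ?S1 = sum ?w (X \<union> ?S1)"
    using fin by (intro sum.union_disjoint[symmetric]) (auto simp: X_def)
  also have "\<dots> \<le> sum ?w ?S"
    using fin r by (intro sum_mono2) (auto simp: X_def)
  finally have S: "sum ?w X + sum ?w ?S1 \<le> sum ?w ?S" .
  have le: "(\<Sum>F\<in>X. ?w F * (1 - excess r (core F))) \<le> weight_diff r u"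
    using sum_single_inner_le[OF r, of u] sum_multiple_inner_le[OF r, of u] S C
    unfolding weight_diff_core X_def[symmetric]
    by (simp add: right_diff_distrib sum_subtractf)
  have pos: "0 < ?w F * (1 - excess r (core F))" for F
    using r ex[of "core F"] by simp
  have finX: "finite X" using fin by (simp add: X_def)
  show "weight_diff r u \<ge> 0"
    by (rule order_trans[OF sum_nonneg le]) (rule less_imp_le[OF pos])
  have "weight_diff r u > 0" if "X \<noteq> {}"
    by (rule less_le_trans[OF sum_pos[OF finX that] le]) (rule pos)
  moreover have "weight_diff r u = 0" if "X = {}"
  proof -
    \<comment> \<open>Straightening a configuration in which exactly one event occurs would produce
      a member of \<open>X\<close>.\<close>
    have "\<not> (F \<in> configs u \<and> (wins_same u F \<or> wins_cross u F))" for F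
    proof
      assume F: "F \<in> configs u \<and> (wins_same u F \<or> wins_cross u F)"
      then have "straighten (core F) F \<in> X"
        using straighten_core[OF not_post_target, of u F u] straighten_subset
        by (auto simp: X_def configs_def)
      then show False using that by simp
    qed
    then have "?S = {}" "?C = {}" by blast+
    then show ?thesis unfolding weight_diff_core by (simp only: sum.empty)
  qed
  ultimately show "weight_diff r u > 0 \<longleftrightarrow> X \<noteq> {}" by auto
qed

text \<open>For existence, \<open>W\<close> is the component of \<open>v\<close> off
  \<open>t\<close> and its boundary is closed on level 1 only. Every outer neighbour of
  \<open>W\<close> lies in \<open>t\<close>, so its vertical edge makes \<open>W\<close>
  good.\<close>

lemma extremal_config_iff:
  "{F. F \<in> configs u \<and> wins_same u F \<and> inner F (core F) = {}} \<noteq> {} \<longleftrightarrow>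
     v \<notin> t \<and> (v, u) \<in> (reach UNIV (verts G - t))\<^sup>*"
proof
  assume "{F. F \<in> configs u \<and> wins_same u F \<and> inner F (core F) = {}} \<noteq> {}"
  then obtain F where F: "u \<in> core F" "wins_same u F" by (auto simp: configs_def)
  then have "core F \<inter> t = {}" using core_disjoint_verticals not_post_target by blast
  moreover from this have "core F \<subseteq> verts G - t" using good_core[of F] by (auto simp: good_def)
  ultimately show "v \<notin> t \<and> (v, u) \<in> (reach UNIV (verts G - t))\<^sup>*"
    using core_connected_UNIV[OF F(1)] v_in_core[of F] reach_mono[of UNIV UNIV "core F" "verts G - t"]
    by blast
next
  assume *: "v \<notin> t \<and> (v, u) \<in> (reach UNIV (verts G - t))\<^sup>*"
  define W where "W = {w. (v, w) \<in> (reach UNIV (verts G - t))\<^sup>*}"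
  define F where "F = bd_edges W \<times> {True}"
  have v: "v \<in> W" by (simp add: W_def)
  have W: "W \<subseteq> verts G - t"
    using * v_in_verts reach_subset[of v _ UNIV "verts G - t"] unfolding W_def by blast
  have out: "y \<in> t" if "link e x y" "x \<in> W" "y \<notin> W" for e x y
  proof (rule ccontr)
    assume "y \<notin> t"
    then have "(x, y) \<in> reach UNIV (verts G - t)"
      using that W link_verts by (auto simp: reach_def)
    then show False using that by (auto simp: W_def intro: rtrancl_into_rtrancl)
  qed
  have good: "good F W"
    unfolding good_def
  proof (intro conjI allI impI)
    fix e x y assume a: "link e x y \<and> x \<in> W \<and> y \<notin> W \<and> \<not> both_closed F e"
    then have "((y, False), (y, \<not> False)) \<in> step F W" using out by (intro step_vertical) auto
    then show "post F W y" unfolding post_def using conn_step by fastforce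
  qed (use v W in auto)
  have con: "(v, w) \<in> (reach UNIV W)\<^sup>*" if "w \<in> W" for w
  proof -
    have "(v, w) \<in> (reach UNIV (verts G - t))\<^sup>*" using that by (simp add: W_def)
    then show ?thesis
    proof (induction rule: rtrancl_induct)
      case (step y z)
      then have "y \<in> W" "z \<in> W" by (auto simp: W_def intro: rtrancl_into_rtrancl)
      then have "(y, z) \<in> reach UNIV W" using step.hyps by (auto simp: reach_def)
      then show ?case using step.IH by (auto intro: rtrancl_into_rtrancl)
    qed simp
  qed
  have inner: "inner F W = {}" by (auto simp: inner_def F_def dest: bd_not_int)
  have "core F = W \<and> wins_same u F"
    using isolated_core[OF good, of u] W con inner * by (auto simp: W_def F_def link_bd_edges)
  then have "F \<in> {F. F \<in> configs u \<and> wins_same u F \<and> inner F (core F) = {}}"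
    using inner * bd_edges_subset by (auto simp: configs_def W_def F_def)
  then show "{F. F \<in> configs u \<and> wins_same u F \<and> inner F (core F) = {}} \<noteq> {}" by blast
qed

subsection \<open>From weights to conditional probabilities\<close>

text \<open>Here 1 + r = 1/p, and with z = 2 i (1 - p) for i inner edges the excess is at most 2^b
  z^2 / (1 - z), where b counts boundary edges. As b + i is at most |E|, the bound on p and i^2
  \<le> (9/8) 2^i give 2^b z^2 \<le> 9/32.\<close>

lemma excess_less_1:
  assumes lower: "1 - 2 powr (- real (card (edges G)) / 2 - 2) \<le> p" and "p < 1"
  shows "excess ((1 - p) / p) W < 1"
proof -
  let ?n = "card (edges G)" and ?b = "card (bd_edges W)" and ?i = "card (int_edges W)"
  define s :: real where "s = 2 powr (- real ?n / 2)"
  define z where "z = 2 * real ?i * (1 - p)"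
  have s0: "0 < s" by (simp add: s_def)
  have "s * s = 2 powr (- real ?n)" unfolding s_def powr_add[symmetric] by simp
  then have s2: "s\<^sup>2 * 2 ^ ?n = 1"
    by (simp add: power2_eq_square powr_realpow[symmetric] powr_add[symmetric])
  have "2 powr (- real ?n / 2 - 2) = s / 4" by (simp add: s_def powr_diff)
  then have q: "1 - p \<le> s / 4" using lower by simp
  have "s \<le> 1" using powr_mono[of "- real ?n / 2" 0 2] by (simp add: s_def)
  then have p: "3 / 4 \<le> p" using q by simp
  have "?b + ?i = card (bd_edges W \<union> int_edges W)"
    using finite_subset[OF int_edges_subset finite_edges] finite_subset[OF bd_edges_subset finite_edges]
    by (intro card_Un_disjoint[symmetric]) (auto dest: bd_not_int)
  also have "\<dots> \<le> ?n" using finite_edges int_edges_subset bd_edges_subset by (intro card_mono) auto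
  finally have bi: "?b + ?i \<le> ?n" .
  have z0: "0 \<le> z" using assms by (simp add: z_def)
  have "z \<le> real ?i * s / 2"
    using mult_left_mono[OF q, of "2 * real ?i"] by (simp add: z_def mult.commute)
  then have "z\<^sup>2 \<le> (real ?i * s / 2)\<^sup>2" using z0 by (rule power_mono)
  also have "\<dots> = real (?i\<^sup>2) * s\<^sup>2 / 4" by (simp add: power2_eq_square)
  also have "\<dots> \<le> (9 / 8 * 2 ^ ?i) * s\<^sup>2 / 4"
  proof -
    have "real (8 * ?i\<^sup>2) \<le> real (9 * 2 ^ ?i)" using eight_squares_le of_nat_mono by blast
    then show ?thesis by (intro divide_right_mono mult_right_mono) auto
  qed
  finally have z2: "z\<^sup>2 \<le> 9 / 32 * (2 ^ ?i * s\<^sup>2)" by simp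
  have "2 ^ ?b * z\<^sup>2 \<le> 9 / 32 * (2 ^ (?b + ?i) * s\<^sup>2)"
    using mult_left_mono[OF z2, of "2 ^ ?b"] by (simp add: power_add mult_ac)
  also have "\<dots> \<le> 9 / 32 * (2 ^ ?n * s\<^sup>2)"
    using bi by (intro mult_left_mono mult_right_mono power_increasing) auto
  finally have bz: "2 ^ ?b * z\<^sup>2 \<le> 9 / 32" using s2 by (simp add: mult.commute)
  moreover have "1 * z\<^sup>2 \<le> 2 ^ ?b * z\<^sup>2" by (intro mult_right_mono) auto
  \<comment> \<open>The value 6/10 leaves room on both sides: its square exceeds 9/32, and so does 1
    - 6/10.\<close>
  ultimately have "z\<^sup>2 < (6 / 10)\<^sup>2" by (simp add: power2_eq_square)
  then have z1: "z < 6 / 10" by (rule power_less_imp_less_base) simp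
  \<comment> \<open>Bernoulli's inequality turns the claim into \<open>2 ^ ?b * z\<^sup>2 < 1 - z\<close>\<close>
  have "1 - z \<le> p ^ (2 * ?i)"
    using Bernoulli_inequality[of "p - 1" "2 * ?i"] p by (simp add: z_def algebra_simps)
  then have "1 / p ^ (2 * ?i) \<le> 1 / (1 - z)" using z1 p by (intro divide_left_mono) auto
  moreover have "1 + (1 - p) / p = 1 / p" using p by (simp add: field_simps)
  moreover have "z \<le> 2 * real ?i * ((1 - p) / p)"
  proof -
    have "(1 - p) * p \<le> (1 - p) * 1" using assms by (intro mult_left_mono) auto
    then have "1 - p \<le> (1 - p) / p" using p by (simp add: le_divide_eq)
    then show ?thesis unfolding z_def by (intro mult_left_mono) auto
  qed
  ultimately have "(1 + (1 - p) / p) ^ (2 * ?i) - 1 - 2 * real ?i * ((1 - p) / p) \<le> 1 / (1 - z) - 1 - z"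
    by (simp add: power_one_over)
  also have "\<dots> = z\<^sup>2 / (1 - z)" using z1 by (simp add: field_simps power2_eq_square)
  finally have "excess ((1 - p) / p) W \<le> 2 ^ ?b * (z\<^sup>2 / (1 - z))"
    unfolding excess_def by (rule mult_left_mono) simp
  also have "\<dots> = 2 ^ ?b * z\<^sup>2 / (1 - z)" by simp
  also have "\<dots> < 1" using bz z1 by (simp add: divide_less_eq)
  finally show ?thesis .
qed

section \<open>From sets of closed edges to percolation configurations\<close>

text \<open>The guards on \<open>e\<close> and \<open>i\<close> produce the value False that
  \<open>percolation\<close> prescribes off the edge set; level 1 corresponds to True.\<close>

definition cfg :: "('e \<times> bool) set \<Rightarrow> ('v, 'e) bb_edge \<Rightarrow> bool" where
  "cfg F x = (case x of Horizontal e i \<Rightarrow> e \<in> edges G \<and> i \<in> {0, 1} \<and> (e, i = 1) \<notin> F | Vertical w \<Rightarrow> w \<in> t)"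

lemma adjacent_cfg:
  assumes "t \<subseteq> verts G"
  shows "adjacent (open_subgraph (bunkbed G) (cfg F)) (x, k) (y, l) \<longleftrightarrow>
    k \<in> {0, 1} \<and> l \<in> {0, 1} \<and> ((x, k = 1), (y, l = 1)) \<in> step F {}"
proof -
  have H: "bb_ends G (Horizontal e i) = Upair (x, k) (y, l) \<longleftrightarrow> k = i \<and> l = i \<and> ends G e = Upair x y" for e i
    by (cases "ends G e") auto
  have "adjacent (open_subgraph (bunkbed G) (cfg F)) (x, k) (y, l) \<longleftrightarrow>
     (\<exists>e i. e \<in> edges G \<and> i \<in> {0, 1} \<and> (e, i = 1) \<notin> F \<and> bb_ends G (Horizontal e i) = Upair (x, k) (y, l)) \<or>
     (\<exists>w. w \<in> t \<and> bb_ends G (Vertical w) = Upair (x, k) (y, l))"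
    (is "_ \<longleftrightarrow> ?rhs")
  proof -
    have "x \<in> edges (bunkbed G) \<and> cfg F x \<longleftrightarrow> (case x of
        Horizontal e i \<Rightarrow> e \<in> edges G \<and> i \<in> {0, 1} \<and> (e, i = 1) \<notin> F | Vertical w \<Rightarrow> w \<in> t)" for x
      using assms by (cases x) (auto simp: cfg_def bunkbed_def)
    moreover have "(\<exists>x. P x) \<longleftrightarrow> (\<exists>e i. P (Horizontal e i)) \<or> (\<exists>w. P (Vertical w))"
      for P :: "('v, 'e) bb_edge \<Rightarrow> bool" by (metis bb_edge.exhaust)
    moreover have "ends (bunkbed G) = bb_ends G" by (simp add: bunkbed_def)
    ultimately show ?thesis by (simp add: adjacent_def open_subgraph_def Bex_def)
  qed
  also have "\<dots> \<longleftrightarrow> k \<in> {0, 1} \<and> l \<in> {0, 1} \<and> ((x, k = 1), (y, l = 1)) \<in> step F {}"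
    unfolding H by (auto simp: step_def link_def)
  finally show ?thesis .
qed

lemma joined_cfg_iff:
  assumes "t \<subseteq> verts G" "u \<in> verts G"
  shows "joined (open_subgraph (bunkbed G) (cfg F)) (u, of_bool i) (w, of_bool j) \<longleftrightarrow> conn F {} (u, i) (w, j)"
proof -
  let ?H = "open_subgraph (bunkbed G) (cfg F)"
  let ?R = "{(a, b). a \<in> verts ?H \<and> b \<in> verts ?H \<and> adjacent ?H a b}"
  let ?\<psi> = "\<lambda>(x, i). (x, of_bool i :: nat)" and ?\<chi> = "\<lambda>(x, k :: nat). (x, k = 1)"
  have V: "verts ?H = verts G \<times> {0, 1}" by (simp add: open_subgraph_def bunkbed_def)
  have 1: "(?\<chi> a, ?\<chi> b) \<in> step F {}" if "(a, b) \<in> ?R" for a b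
    using that adjacent_cfg[OF assms(1)] by (auto simp: V)
  have 2: "(?\<psi> a, ?\<psi> b) \<in> ?R" if s: "(a, b) \<in> step F {}" for a b
  proof -
    obtain x i y j where ab: "a = (x, i)" "b = (y, j)" by fastforce
    then have "x \<in> verts G" "y \<in> verts G"
      using s link_verts assms(1) by (auto elim!: step_cases)
    moreover have "adjacent ?H (x, of_bool i) (y, of_bool j)"
      unfolding adjacent_cfg[OF assms(1)] using s ab by (simp del: One_nat_def)
    ultimately show ?thesis by (simp add: V ab)
  qed
  have 3: "(?\<chi> a, ?\<chi> b) \<in> (step F {})\<^sup>*" if "(a, b) \<in> ?R\<^sup>*" for a b
    using that
  proof (induction rule: rtrancl_induct)
    case (step y z)
    from rtrancl_into_rtrancl[OF step.IH 1[OF step.hyps(2)]] show ?case .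
  qed (rule rtrancl_refl)
  have 4: "(?\<psi> a, ?\<psi> b) \<in> ?R\<^sup>*" if "(a, b) \<in> (step F {})\<^sup>*" for a b
    using that
  proof (induction rule: rtrancl_induct)
    case (step y z)
    from rtrancl_into_rtrancl[OF step.IH 2[OF step.hyps(2)]] show ?case .
  qed (rule rtrancl_refl)
  have "((u, of_bool i), (w, of_bool j)) \<in> ?R\<^sup>* \<longleftrightarrow> ((u, i), (w, j)) \<in> (step F {})\<^sup>*"
  proof
    assume "((u, of_bool i), (w, of_bool j)) \<in> ?R\<^sup>*"
    from 3[OF this] show "((u, i), (w, j)) \<in> (step F {})\<^sup>*"
      by (simp only: prod.case of_bool_eq_1_iff)
  next
    assume "((u, i), (w, j)) \<in> (step F {})\<^sup>*"
    from 4[OF this] show "((u, of_bool i), (w, of_bool j)) \<in> ?R\<^sup>*"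
      by (simp only: prod.case)
  qed
  then show ?thesis using assms(2) by (simp add: joined_iff_rtrancl V conn_def)
qed

text \<open>For \<open>t\<close> inside the vertex set, the probability that T = t and all
  horizontal edges are open. Each closure then replaces a factor p by 1 - p.\<close>

definition config_const :: "real \<Rightarrow> real" where
  "config_const p = p ^ (2 * card (edges G)) * (\<Prod>w\<in>verts G. pmf (bernoulli_pmf p) (w \<in> t))"

lemma config_const_pos: "0 < p \<Longrightarrow> p < 1 \<Longrightarrow> 0 < config_const p"
proof -
  assume "0 < p" "p < 1"
  then have "0 < pmf (bernoulli_pmf p) b" for b by (cases b) simp_all
  then show ?thesis unfolding config_const_def using \<open>0 < p\<close> by (intro mult_pos_pos prod_pos) auto
qed

lemma finite_bunkbed_edges: "finite (edges (bunkbed G))"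
proof -
  have "{Horizontal e i :: ('v, 'e) bb_edge | e i. e \<in> edges G \<and> i \<in> {0, 1}} = case_prod Horizontal ` (edges G \<times> {0, 1})"
    by auto
  then show ?thesis using finite_edges finite_verts by (simp add: bunkbed_def)
qed

lemma pmf_percolation_cfg:
  assumes "t \<subseteq> verts G" "F \<subseteq> edges G \<times> UNIV" "0 < p" "p < 1"
  shows "pmf (percolation (bunkbed G) p) (cfg F) = config_const p * ((1 - p) / p) ^ card F"
proof -
  let ?b = "pmf (bernoulli_pmf p)"
  let ?h = "\<lambda>(e, i). Horizontal e (of_bool i :: nat) :: ('v, 'e) bb_edge"
  have E: "edges (bunkbed G) = ?h ` (edges G \<times> UNIV) \<union> Vertical ` verts G"
    by (auto simp: bunkbed_def UNIV_bool image_iff)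
  have inj: "inj_on ?h (edges G \<times> UNIV)"
    by (rule inj_onI) (auto simp: of_bool_def split: if_splits)
  have "cfg F x = False" if "x \<notin> edges (bunkbed G)" for x
    using that assms(1) by (auto simp: cfg_def bunkbed_def split: bb_edge.splits)
  then have "pmf (percolation (bunkbed G) p) (cfg F) = (\<Prod>x\<in>edges (bunkbed G). ?b (cfg F x))"
    unfolding percolation_def using finite_bunkbed_edges by (subst pmf_Pi') auto
  also have "\<dots> = (\<Prod>x\<in>?h ` (edges G \<times> UNIV). ?b (cfg F x)) * (\<Prod>x\<in>Vertical ` verts G. ?b (cfg F x))"
    unfolding E using finite_edges finite_verts by (intro prod.union_disjoint) auto
  also have "(\<Prod>x\<in>Vertical ` verts G. ?b (cfg F x)) = (\<Prod>w\<in>verts G. ?b (w \<in> t))"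
    by (subst prod.reindex) (auto simp: cfg_def intro: inj_onI)
  also have "(\<Prod>x\<in>?h ` (edges G \<times> UNIV). ?b (cfg F x)) =
      (\<Prod>a\<in>edges G \<times> UNIV. p * (if a \<in> F then (1 - p) / p else 1))"
    unfolding prod.reindex[OF inj] using assms
    by (intro prod.cong) (auto simp: cfg_def of_bool_def split: if_splits)
  also have "\<dots> = p ^ (2 * card (edges G)) * (\<Prod>a\<in>edges G \<times> (UNIV :: bool set). if a \<in> F then (1 - p) / p else 1)"
    by (simp add: prod.distrib card_cartesian_product mult.commute)
  also have "(\<Prod>a\<in>edges G \<times> (UNIV :: bool set). if a \<in> F then (1 - p) / p else 1) = ((1 - p) / p) ^ card F"
    using assms(2) finite_edges by (simp add: prod.inter_restrict[symmetric] Int_absorb1)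
  finally show ?thesis by (simp add: config_const_def)
qed

lemma open_verticals_cfg: "t \<subseteq> verts G \<Longrightarrow> open_verticals G (cfg F) = t"
  by (auto simp: open_verticals_def cfg_def)

lemma cfg_surj:
  assumes "\<omega> \<in> set_pmf (percolation (bunkbed G) p)" "open_verticals G \<omega> = t"
  shows "\<exists>F. F \<subseteq> edges G \<times> UNIV \<and> \<omega> = cfg F"
proof (intro exI conjI)
  let ?F = "{(e, i). e \<in> edges G \<and> \<not> \<omega> (Horizontal e (of_bool i))}"
  show "?F \<subseteq> edges G \<times> UNIV" by auto
  have out: "\<not> \<omega> x" if "x \<notin> edges (bunkbed G)" for x
  proof -
    have "\<omega> \<in> {f. \<forall>x. x \<notin> edges (bunkbed G) \<longrightarrow> f x = False}"
      using assms(1) unfolding percolation_def by (rule subsetD[OF set_Pi_pmf_subset[OF finite_bunkbed_edges]])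
    then show ?thesis using that by simp
  qed
  show "\<omega> = cfg ?F"
  proof
    fix x show "\<omega> x = cfg ?F x"
    proof (cases x)
      case (Horizontal e i)
      show ?thesis
      proof (cases "e \<in> edges G \<and> i \<in> {0, 1}")
        case True
        then show ?thesis using Horizontal by (auto simp: cfg_def)
      next
        case False
        then have "x \<notin> edges (bunkbed G)" using Horizontal by (auto simp: bunkbed_def)
        then show ?thesis using out False Horizontal by (auto simp: cfg_def)
      qed
    next
      case (Vertical w)
      show ?thesis
      proof (cases "w \<in> verts G")
        case True
        then show ?thesis using Vertical assms(2) by (auto simp: cfg_def open_verticals_def)
      next
        case False
        then have "x \<notin> edges (bunkbed G)" using Vertical by (auto simp: bunkbed_def)
        then show ?thesis using out False Vertical assms(2) by (auto simp: cfg_def open_verticals_def)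
      qed
    qed
  qed
qed

lemma inj_on_cfg: "inj_on cfg (Pow (edges G \<times> UNIV))"
proof (rule inj_onI)
  fix F F' assume F: "F \<in> Pow (edges G \<times> UNIV)" "F' \<in> Pow (edges G \<times> UNIV)" "cfg F = cfg F'"
  have "(e, i) \<in> F \<longleftrightarrow> (e, i) \<in> F'" for e i
    using F(1,2) fun_cong[OF F(3), of "Horizontal e (of_bool i)"] by (cases i) (auto simp: cfg_def)
  then show "F = F'" by auto
qed

text \<open>Up to a null set, the configurations with T = t are exactly the \<open>cfg F\<close>,
  each for a single \<open>F\<close>.\<close>

lemma prob_open_verticals:
  assumes "t \<subseteq> verts G" "0 < p" "p < 1"
  shows "\<P>(\<omega> in percolation (bunkbed G) p. A \<omega> \<and> open_verticals G \<omega> = t) =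
    config_const p * (\<Sum>F\<in>Pow (edges G \<times> UNIV). ((1 - p) / p) ^ card F * of_bool (A (cfg F)))"
proof -
  let ?M = "percolation (bunkbed G) p" and ?S = "{\<omega>. A \<omega> \<and> open_verticals G \<omega> = t}"
  let ?B = "{F \<in> Pow (edges G \<times> (UNIV :: bool set)). A (cfg F)}"
  have "measure_pmf.prob ?M ?S = measure_pmf.prob ?M (?S \<inter> set_pmf ?M)"
    by (simp add: measure_Int_set_pmf)
  also have "\<dots> \<le> measure_pmf.prob ?M (cfg ` ?B)"
  proof (intro measure_pmf.finite_measure_mono subsetI)
    fix \<omega> assume \<omega>: "\<omega> \<in> ?S \<inter> set_pmf ?M"
    then obtain F where "F \<subseteq> edges G \<times> UNIV" "\<omega> = cfg F" using cfg_surj[of \<omega> p] by blast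
    then show "\<omega> \<in> cfg ` ?B" using \<omega> by blast
  qed simp
  finally have le: "measure_pmf.prob ?M ?S \<le> measure_pmf.prob ?M (cfg ` ?B)" .
  have "cfg ` ?B \<subseteq> ?S" using open_verticals_cfg assms(1) by auto
  then have "measure_pmf.prob ?M (cfg ` ?B) \<le> measure_pmf.prob ?M ?S"
    by (intro measure_pmf.finite_measure_mono) auto
  with le have "measure_pmf.prob ?M ?S = measure_pmf.prob ?M (cfg ` ?B)" by (rule antisym)
  also have "\<dots> = sum (pmf ?M) (cfg ` ?B)"
    using finite_configs by (intro measure_measure_pmf_finite) simp
  also have "\<dots> = (\<Sum>F\<in>?B. pmf ?M (cfg F))"
    by (subst sum.reindex) (auto intro: inj_on_subset[OF inj_on_cfg])
  also have "\<dots> = (\<Sum>F\<in>?B. config_const p * ((1 - p) / p) ^ card F)"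
    using assms by (intro sum.cong) (auto simp: pmf_percolation_cfg)
  also have "\<dots> = (\<Sum>F\<in>Pow (edges G \<times> UNIV). if A (cfg F) then config_const p * ((1 - p) / p) ^ card F else 0)"
    using finite_configs by (rule sum.inter_filter)
  finally show ?thesis
    by (simp add: sum_distrib_left of_bool_def if_distrib mult.assoc cong: if_cong)
qed

text \<open>The factor \<open>config_const p\<close> cancels in the conditioning, so
  \<open>c\<close> is the reciprocal of the total weight of all sets of closed edges.\<close>

lemma bb_cond_prob_diff:
  assumes "t \<subseteq> verts G" "u \<in> verts G" "0 < p" "p < 1"
  obtains c where "0 < c"
    "bb_cond_prob G p (u, 0) (v, 0) t - bb_cond_prob G p (u, 0) (v, 1) t = c * weight_diff ((1 - p) / p) u"
proof -
  let ?r = "(1 - p) / p" and ?P = "Pow (edges G \<times> (UNIV :: bool set))"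
  define D where "D = \<P>(\<omega> in percolation (bunkbed G) p. open_verticals G \<omega> = t)"
  have "D = config_const p * (\<Sum>F\<in>?P. ?r ^ card F)"
    using prob_open_verticals[OF assms(1,3,4), of "\<lambda>_. True"] by (simp add: D_def)
  moreover have "0 < (\<Sum>F\<in>?P. ?r ^ card F)"
    using finite_configs assms by (intro sum_pos) auto
  ultimately have D: "0 < D" using config_const_pos assms by simp
  have j: "bb_cond_prob G p (u, 0) (v, of_bool i) t =
      config_const p / D * (\<Sum>F\<in>?P. ?r ^ card F * of_bool (conn F {} (u, False) (v, i)))" for i
    using prob_open_verticals[OF assms(1,3,4), of "\<lambda>\<omega>. joined (open_subgraph (bunkbed G) \<omega>) (u, 0) (v, of_bool i)"]
      joined_cfg_iff[OF assms(1,2), of _ False v i]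
    unfolding bb_cond_prob_def cond_prob_def D_def by simp
  show thesis
  proof
    show "0 < config_const p / D" using D config_const_pos assms by simp
    show "bb_cond_prob G p (u, 0) (v, 0) t - bb_cond_prob G p (u, 0) (v, 1) t
        = config_const p / D * weight_diff ?r u"
      using j[of False] j[of True] by (simp add: weight_diff_def right_diff_distrib sum_subtractf)
  qed
qed

text \<open>The clause on \<open>v\<close> rules out the trivial walk when u = v lies in
  \<open>t\<close>; a nontrivial walk stays off \<open>t\<close> by itself.\<close>

lemma joined_induced_iff:
  assumes "u \<in> verts G"
  shows "joined (induced_subgraph G (verts G - t)) u v \<longleftrightarrow> v \<notin> t \<and> (v, u) \<in> (reach UNIV (verts G - t))\<^sup>*"
proof -
  let ?H = "induced_subgraph G (verts G - t)"
  have "{(a, b). a \<in> verts ?H \<and> b \<in> verts ?H \<and> adjacent ?H a b} = reach UNIV (verts G - t)"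
    by (auto simp: induced_subgraph_def adjacent_def reach_def link_def)
  then have "joined ?H u v \<longleftrightarrow> u \<in> verts G - t \<and> (u, v) \<in> (reach UNIV (verts G - t))\<^sup>*"
    by (simp add: joined_iff_rtrancl) (simp add: induced_subgraph_def)
  then show ?thesis
    using assms v_in_verts reach_sym reach_subset[of u v UNIV "verts G - t"] reach_subset[of v u UNIV "verts G - t"]
    by blast
qed

end

theorem theorem2p1:
  fixes G :: "('v, 'e) multigraph" and u v :: 'v and t :: "'v set" and p :: real
  assumes "finite_multigraph G"
    and "u \<in> verts G" and "v \<in> verts G" and "t \<subseteq> verts G"
    and "1 - 2 powr (- real (card (edges G)) / 2 - 2) \<le> p" and "p < 1"
  shows "bb_cond_prob G p (u, 0) (v, 0) t \<ge> bb_cond_prob G p (u, 0) (v, 1) t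
    \<and> (bb_cond_prob G p (u, 0) (v, 0) t > bb_cond_prob G p (u, 0) (v, 1) t
        \<longleftrightarrow> joined (induced_subgraph G (verts G - t)) u v)"
proof -
  interpret bunkbed_target G t v
    using assms by (simp add: bunkbed_target_def bunkbed_target_axioms_def)
  \<comment> \<open>The exponent is negative, so the lower bound on \<open>p\<close> is
    positive.\<close>
  have "2 powr (- real (card (edges G)) / 2 - 2) < (2 :: real) powr 0" by (rule powr_less_mono) auto
  then have "0 < p" using assms(5) by simp
  then have r: "0 < (1 - p) / p" using assms(6) by simp
  obtain c where c: "0 < c"
    "bb_cond_prob G p (u, 0) (v, 0) t - bb_cond_prob G p (u, 0) (v, 1) t = c * weight_diff ((1 - p) / p) u"
    using bb_cond_prob_diff[OF assms(4,2) \<open>0 < p\<close> assms(6)] by blast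
  note sign = weight_diff_sign[OF r excess_less_1[OF assms(5,6)], of u]
  have "0 \<le> c * weight_diff ((1 - p) / p) u" using c(1) sign(1) by simp
  moreover have "0 < c * weight_diff ((1 - p) / p) u \<longleftrightarrow> joined (induced_subgraph G (verts G - t)) u v"
    using c(1) sign(2) unfolding extremal_config_iff joined_induced_iff[OF assms(2)]
    by (simp add: zero_less_mult_iff)
  ultimately show ?thesis using c(2) by linarith
qed

end
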